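(* Let $f:\mathbb{R}^n\to\mathbb{R}$ be of class $C^{2+}$ with $L_f$-Lipschitz continuous gradient, let $g:\mathbb{R}^n\to\mathbb{R}\cup\{+\infty\}$ be proper, lower semicontinuous and $\rho$-weakly convex, let $\varphi=f+g$ with $\operatorname{argmin}\varphi\neq\emptyset$, and suppose $\{x:\varphi(x)\le\varphi(x^0)\}$ is bounded. Let $(x^k)$ be generated by the NTRA algorithm described in the context, and suppose: $x^\star$ is a critical point which is a limit point of $(x^k)$; $f$ is of class $C^3$ locally around $x^\star$ and $\operatorname{prox}_{\gamma g}$ is of class $C^1$ locally around $x^\star-\gamma\nabla f(x^\star)$ (with $\gamma$ the algorithm's stepsize, assumed sufficiently small); $x^\star$ is a strong local minimizer of $\varphi$; there is $\beta\in(0,1)$ with $m_k(0)-m_k(d^k)\ge\beta\|\nabla\varphi_\gamma(x^k)\|\min\{\delta_k,\|\nabla\varphi_\gamma(x^k)\|/\|B_k\|\}$ for all $k$; and whenever $B_k\succ0$ and $d_N^k:=-B_k^{-1}\nabla\varphi_\gamma(x^k)$ satisfies $\|d_N^k\|\le\delta_k$, one has $d^k=d_N^k$. Then (i) the whole sequence $(x^k)$ converges to $x^\star$; (ii) eventually $d^k=d_N^k$ and this step is accepted, and $(x^k)$ converges to $x^\star$ superlinearly.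
   Context: $C^{2+}$: twice continuously differentiable with locally Lipschitz Hessian; $g$ is $\rho$-weakly convex if $g+\frac\rho2\|\cdot\|^2$ is convex. $\operatorname{prox}_{\gamma g}(x)=\operatorname{argmin}_z\{g(z)+\frac1{2\gamma}\|z-x\|^2\}$, $T_\gamma(x)=\operatorname{prox}_{\gamma g}(x-\gamma\nabla f(x))$, $R_\gamma(x)=\gamma^{-1}(x-T_\gamma(x))$; $x^\star$ is critical if $x^\star\in T_\gamma(x^\star)$. A strong local minimizer $x^\star$ of $\varphi$: there exist $c,\epsilon>0$ with $\varphi(x)\ge\varphi(x^\star)+c\|x-x^\star\|^2$ for all $x$ with $\|x-x^\star\|<\epsilon$. Forward-backward envelope $\varphi_\gamma(x)=\inf_u\{f(x)+\langle\nabla f(x),u-x\rangle+g(u)+\frac1{2\gamma}\|u-x\|^2\}$. $\partial_C$: Clarke generalized Jacobian. NTRA: given $x^0$, $\gamma\in(0,\min\{1/L_f,1/\rho\})$, $\delta_0>0$, $0<\mu_1<\mu_2<1$, $0<c_1<c_2<1<c_3$; for $k=0,1,\dots$: select $P_k\in\partial_C\operatorname{prox}_{\gamma g}(x^k-\gamma\nabla f(x^k))$; $Q_k=I-\gamma\nabla^2f(x^k)$, $B_k=\gamma^{-1}Q_k(I-P_kQ_k)$; stop if $R_\gamma(x^k)=0$ and $\lambda_{\min}(B_k)\ge0$; $d^k$ is an (approximate) solution of $\min_d m_k(d):=\varphi_\gamma(x^k)+\langle\nabla\varphi_\gamma(x^k),d\rangle+\frac12\langle B_kd,d\rangle$ s.t.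 $\|d\|\le\delta_k$; $\rho_k=\frac{\varphi_\gamma(x^k)-\varphi_\gamma(x^k+d^k)}{m_k(0)-m_k(d^k)}$; $x^{k+1}=x^k$ if $\rho_k<\mu_1$, else $x^k+d^k$; $\delta_{k+1}=c_1\delta_k$ if $\rho_k<\mu_1$, $c_2\delta_k$ if $\mu_1\le\rho_k<\mu_2$, $c_3\delta_k$ if $\rho_k\ge\mu_2$. *)

theory Defs
  imports "HOL-Analysis.Analysis" "HOL-Library.Landau_Symbols"
begin

definition lsc_fun :: "('a::topological_space \<Rightarrow> ereal) \<Rightarrow> bool" where
  "lsc_fun g \<longleftrightarrow> (\<forall>x. g x \<le> Liminf (at x) g)"

definition proper_fun :: "('a \<Rightarrow> ereal) \<Rightarrow> bool" where
  "proper_fun g \<longleftrightarrow> (\<forall>x. g x \<noteq> -\<infinity>) \<and> (\<exists>x. g x \<noteq> \<infinity>)"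

definition convex_efun :: "('a::real_vector \<Rightarrow> ereal) \<Rightarrow> bool" where
  "convex_efun h \<longleftrightarrow> (\<forall>x y t. 0 \<le> t \<and> t \<le> 1 \<longrightarrow>
      h ((1 - t) *\<^sub>R x + t *\<^sub>R y) \<le> ereal (1 - t) * h x + ereal t * h y)"

definition weakly_convex :: "real \<Rightarrow> ('a::real_normed_vector \<Rightarrow> ereal) \<Rightarrow> bool" where
  "weakly_convex \<rho> g \<longleftrightarrow> convex_efun (\<lambda>x. g x + ereal (\<rho> / 2 * (norm x)\<^sup>2))"

definition prox :: "real \<Rightarrow> ('a::real_normed_vector \<Rightarrow> ereal) \<Rightarrow> 'a \<Rightarrow> 'a" where
  "prox \<gamma> g x = (THE z. \<forall>w. g z + ereal ((norm (z - x))\<^sup>2 / (2 * \<gamma>))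
                            \<le> g w + ereal ((norm (w - x))\<^sup>2 / (2 * \<gamma>)))"

definition fb_op :: "real \<Rightarrow> ('a::real_normed_vector \<Rightarrow> 'a) \<Rightarrow> ('a \<Rightarrow> ereal) \<Rightarrow> 'a \<Rightarrow> 'a" where
  "fb_op \<gamma> gradf g x = prox \<gamma> g (x - \<gamma> *\<^sub>R gradf x)"

definition fb_res :: "real \<Rightarrow> ('a::real_normed_vector \<Rightarrow> 'a) \<Rightarrow> ('a \<Rightarrow> ereal) \<Rightarrow> 'a \<Rightarrow> 'a" where
  "fb_res \<gamma> gradf g x = (1 / \<gamma>) *\<^sub>R (x - fb_op \<gamma> gradf g x)"

definition critical_pt :: "real \<Rightarrow> ('a::real_normed_vector \<Rightarrow> 'a) \<Rightarrow> ('a \<Rightarrow> ereal) \<Rightarrow> 'a \<Rightarrow> bool" where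
  "critical_pt \<gamma> gradf g x \<longleftrightarrow> x = fb_op \<gamma> gradf g x"

text \<open>Forward-backward envelope (finite under the standing assumptions).\<close>
definition fbe :: "real \<Rightarrow> ('a::real_inner \<Rightarrow> real) \<Rightarrow> ('a \<Rightarrow> 'a) \<Rightarrow> ('a \<Rightarrow> ereal) \<Rightarrow> 'a \<Rightarrow> real" where
  "fbe \<gamma> f gradf g x = real_of_ereal (INF u. ereal (f x + gradf x \<bullet> (u - x)) + g u
                                      + ereal ((norm (u - x))\<^sup>2 / (2 * \<gamma>)))"

definition fbe_grad :: "real \<Rightarrow> ('a::real_inner \<Rightarrow> real) \<Rightarrow> ('a \<Rightarrow> 'a) \<Rightarrow> ('a \<Rightarrow> ereal) \<Rightarrow> 'a \<Rightarrow> 'a" where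
  "fbe_grad \<gamma> f gradf g x = (THE v. (fbe \<gamma> f gradf g has_derivative (\<lambda>h. v \<bullet> h)) (at x))"

definition clarke_jac :: "(real^'n \<Rightarrow> real^'n) \<Rightarrow> real^'n \<Rightarrow> (real^'n^'n) set" where
  "clarke_jac F z = convex hull {M. \<exists>s J. s \<longlonglongrightarrow> z \<and> J \<longlonglongrightarrow> M \<and>
      (\<forall>k. (F has_derivative (\<lambda>h. J k *v h)) (at (s k)))}"

definition min_eig_nonneg :: "real^'n^'n \<Rightarrow> bool" where
  "min_eig_nonneg B \<longleftrightarrow> (\<forall>e v. v \<noteq> 0 \<and> B *v v = e *\<^sub>R v \<longrightarrow> e \<ge> 0)"

definition pos_def :: "real^'n^'n \<Rightarrow> bool" where
  "pos_def B \<longleftrightarrow> (\<forall>v. v \<noteq> 0 \<longrightarrow> v \<bullet> (B *v v) > 0)"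

definition mat_norm :: "real^'n^'n \<Rightarrow> real" where
  "mat_norm B = onorm (\<lambda>v. B *v v)"

definition Qmat :: "real \<Rightarrow> (real^'n \<Rightarrow> real^'n^'n) \<Rightarrow> real^'n \<Rightarrow> real^'n^'n" where
  "Qmat \<gamma> hessf x = mat 1 - \<gamma> *\<^sub>R hessf x"

definition Bmat :: "real \<Rightarrow> (real^'n \<Rightarrow> real^'n^'n) \<Rightarrow> real^'n \<Rightarrow> real^'n^'n \<Rightarrow> real^'n^'n" where
  "Bmat \<gamma> hessf x P = (1 / \<gamma>) *\<^sub>R (Qmat \<gamma> hessf x ** (mat 1 - P ** Qmat \<gamma> hessf x))"

definition tr_model :: "real \<Rightarrow> (real^'n \<Rightarrow> real) \<Rightarrow> (real^'n \<Rightarrow> real^'n) \<Rightarrow> (real^'n \<Rightarrow> real^'n^'n)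
    \<Rightarrow> (real^'n \<Rightarrow> ereal) \<Rightarrow> real^'n \<Rightarrow> real^'n^'n \<Rightarrow> real^'n \<Rightarrow> real" where
  "tr_model \<gamma> f gradf hessf g x P d = fbe \<gamma> f gradf g x + fbe_grad \<gamma> f gradf g x \<bullet> d
       + 1/2 * (d \<bullet> (Bmat \<gamma> hessf x P *v d))"

definition tr_ratio :: "real \<Rightarrow> (real^'n \<Rightarrow> real) \<Rightarrow> (real^'n \<Rightarrow> real^'n) \<Rightarrow> (real^'n \<Rightarrow> real^'n^'n)
    \<Rightarrow> (real^'n \<Rightarrow> ereal) \<Rightarrow> real^'n \<Rightarrow> real^'n^'n \<Rightarrow> real^'n \<Rightarrow> real" where
  "tr_ratio \<gamma> f gradf hessf g x P d =
     (fbe \<gamma> f gradf g x - fbe \<gamma> f gradf g (x + d)) /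
     (tr_model \<gamma> f gradf hessf g x P 0 - tr_model \<gamma> f gradf hessf g x P d)"

text \<open>An (infinite) run of NTRA: iterates x, steps d, radii \<delta>, chosen Clarke Jacobians P.
  The step d k is an approximate trust-region solution (feasible); its quality is imposed by
  separate hypotheses in the theorem. The stopping test never fires (infinite sequence).\<close>
definition ntra_run :: "real \<Rightarrow> (real^'n \<Rightarrow> real) \<Rightarrow> (real^'n \<Rightarrow> real^'n) \<Rightarrow> (real^'n \<Rightarrow> real^'n^'n)
    \<Rightarrow> (real^'n \<Rightarrow> ereal) \<Rightarrow> real \<Rightarrow> real \<Rightarrow> real \<Rightarrow> real \<Rightarrow> real \<Rightarrow> real \<Rightarrow> real^'n
    \<Rightarrow> (nat \<Rightarrow> real^'n) \<Rightarrow> (nat \<Rightarrow> real^'n) \<Rightarrow> (nat \<Rightarrow> real) \<Rightarrow> (nat \<Rightarrow> real^'n^'n) \<Rightarrow> bool" where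
  "ntra_run \<gamma> f gradf hessf g \<delta>0 \<mu>1 \<mu>2 c1 c2 c3 x0 x d \<delta> P \<longleftrightarrow>
     \<delta>0 > 0 \<and> 0 < \<mu>1 \<and> \<mu>1 < \<mu>2 \<and> \<mu>2 < 1 \<and> 0 < c1 \<and> c1 < c2 \<and> c2 < 1 \<and> 1 < c3 \<and>
     x 0 = x0 \<and> \<delta> 0 = \<delta>0 \<and>
     (\<forall>k. P k \<in> clarke_jac (prox \<gamma> g) (x k - \<gamma> *\<^sub>R gradf (x k))) \<and>
     (\<forall>k. \<not> (fb_res \<gamma> gradf g (x k) = 0 \<and> min_eig_nonneg (Bmat \<gamma> hessf (x k) (P k)))) \<and>
     (\<forall>k. norm (d k) \<le> \<delta> k) \<and>
     (\<forall>k. x (Suc k) = (if tr_ratio \<gamma> f gradf hessf g (x k) (P k) (d k) < \<mu>1 then x k else x k + d k)) \<and>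
     (\<forall>k. \<delta> (Suc k) = (if tr_ratio \<gamma> f gradf hessf g (x k) (P k) (d k) < \<mu>1 then c1 * \<delta> k
                       else if tr_ratio \<gamma> f gradf hessf g (x k) (P k) (d k) < \<mu>2 then c2 * \<delta> k
                       else c3 * \<delta> k))"

text \<open>min{\<delta>, a / \<parallel>B\<parallel>} with the convention a/0 = +\<infinity>.\<close>
definition cauchy_min :: "real \<Rightarrow> real \<Rightarrow> real^'n^'n \<Rightarrow> real" where
  "cauchy_min \<delta> a B = (if mat_norm B = 0 then \<delta> else min \<delta> (a / mat_norm B))"

end

theory Submission
  imports Defs
begin

text \<open>
  Completing the square writes the forward-backward envelope as
  \<open>f - \<gamma>/2 \<parallel>\<nabla>f\<parallel>\<^sup>2\<close> plus the Moreau envelope of \<open>g\<close> at \<open>x - \<gamma>\<nabla>f(x)\<close>, so its gradient is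
  \<open>Q(x) R\<^sub>\<gamma>(x)\<close> wherever the proximal map is continuous. Near the critical point the proximal map
  is \<open>C\<^sup>1\<close>; as \<open>R\<^sub>\<gamma>\<close> vanishes there, this gradient is strictly differentiable with derivative the
  matrix \<open>B\<close> of the algorithm, and strong minimality makes \<open>B\<close> coercive.

  The trust-region argument is then purely local. Near the limit point a step that does not
  increase the model has length \<open>O(\<parallel>x\<^sub>k - x\<^sup>*\<parallel>)\<close>; since the envelope decreases along the iterates
  and grows quadratically around \<open>x\<^sup>*\<close>, an iterate that comes close enough never leaves. Once
  the iterates converge, the Cauchy decrease dominates the second-order model error, every step is
  very successful, the radii grow geometrically, and Newton steps take over.
\<close>

subsection \<open>Strictly differentiable gradients\<close>

text \<open>The derivative of the Taylor remainder along the segment is the gradient error paired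
  with \<open>d\<close>, so the mean value theorem and Cauchy-Schwarz suffice. With
  \<open>w = 0\<close> this is a first-order bound, with \<open>w = B *v d\<close> a second-order
  one.\<close>

lemma second_order_taylor_bound:
  fixes F :: "'a::real_inner \<Rightarrow> real"
  assumes der: "\<And>t. 0 \<le> t \<Longrightarrow> t \<le> 1 \<Longrightarrow>
      (F has_derivative (\<lambda>h. G (x + t *\<^sub>R d) \<bullet> h)) (at (x + t *\<^sub>R d))"
    and bound: "\<And>t. 0 \<le> t \<Longrightarrow> t \<le> 1 \<Longrightarrow> norm (G (x + t *\<^sub>R d) - G x - t *\<^sub>R w) \<le> e * norm d"
  shows "\<bar>F (x + d) - F x - G x \<bullet> d - (d \<bullet> w) / 2\<bar> \<le> e * (norm d)\<^sup>2"
proof -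
  define \<psi> where "\<psi> t = F (x + t *\<^sub>R d) - t * (G x \<bullet> d) - t\<^sup>2 / 2 * (d \<bullet> w)" for t
  have d\<psi>: "(\<psi> has_derivative (\<lambda>h. h * ((G (x + t *\<^sub>R d) - G x - t *\<^sub>R w) \<bullet> d))) (at t within {0..1})"
    if t: "0 \<le> t" "t \<le> 1" for t
  proof -
    have "((\<lambda>t. F (x + t *\<^sub>R d)) has_derivative (\<lambda>h. G (x + t *\<^sub>R d) \<bullet> (h *\<^sub>R d))) (at t within {0..1})"
      by (rule has_derivative_compose[where f = "\<lambda>t. x + t *\<^sub>R d", OF _ der[OF t]])
        (auto intro!: derivative_eq_intros)
    then show ?thesis
      unfolding \<psi>_def
      by (auto intro!: derivative_eq_intros simp: algebra_simps inner_commute)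
  qed
  obtain t where t: "t \<in> {0..1}"
    and eq: "\<psi> 1 - \<psi> 0 = (1 - 0) * ((G (x + t *\<^sub>R d) - G x - t *\<^sub>R w) \<bullet> d)"
    using mvt_very_simple[of 0 1 \<psi>, OF _ d\<psi>] by auto
  have "\<bar>\<psi> 1 - \<psi> 0\<bar> \<le> norm (G (x + t *\<^sub>R d) - G x - t *\<^sub>R w) * norm d"
    unfolding eq using Cauchy_Schwarz_ineq2 by simp
  also have "\<dots> \<le> e * norm d * norm d"
    using bound t by (intro mult_right_mono) auto
  finally show ?thesis
    by (simp add: \<psi>_def power2_eq_square algebra_simps)
qed

section \<open>Matrix estimates and the Cauchy radius\<close>

lemma norm_matrix_vector_mult_le: "norm (A *v v) \<le> norm A * norm v"
  for A :: "real^'n^'m"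
proof -
  have "norm (A *v v) \<le> L2_set (\<lambda>i. norm v * norm (A $ i)) UNIV"
    unfolding norm_vec_def[of "A *v v"]
  proof (rule L2_set_mono)
    fix i
    have "(A *v v) $ i = A $ i \<bullet> v"
      by (simp add: matrix_vector_mult_def inner_vec_def)
    then show "norm ((A *v v) $ i) \<le> norm v * norm (A $ i)"
      using Cauchy_Schwarz_ineq2[of "A $ i" v] by (simp add: mult.commute)
  qed simp
  also have "\<dots> = norm v * norm A"
    by (simp add: L2_set_right_distrib norm_vec_def[of A])
  finally show ?thesis by (simp add: mult.commute)
qed

lemma bounded_bilinear_matrix_vector_mult:
  "bounded_bilinear ((*v) :: real^'n^'m \<Rightarrow> real^'n \<Rightarrow> real^'m)"
proof
  show "\<exists>K. \<forall>(A::real^'n^'m) v. norm (A *v v) \<le> norm A * norm v * K"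
    using norm_matrix_vector_mult_le by (intro exI[of _ 1]) auto
qed (simp_all add: matrix_vector_mult_add_rdistrib matrix_vector_right_distrib
      scaleR_matrix_vector_assoc matrix_vector_mult_scaleR)

lemmas has_derivative_matrix_vector_mult =
  bounded_bilinear.FDERIV[OF bounded_bilinear_matrix_vector_mult]

text \<open>A kernel vector would have zero quadratic form, so the square matrix is injective and
  hence invertible; \<open>matrix_inv\<close> is a choice, resolved by existence.\<close>

lemma pos_def_matrix_inv:
  fixes B :: "real^'n^'n"
  assumes "pos_def B"
  shows "B *v (matrix_inv B *v v) = v"
proof -
  have "inj ((*v) B)"
  proof (rule injI)
    fix u w assume "B *v u = B *v w"
    then have "(u - w) \<bullet> (B *v (u - w)) = 0"
      by (simp add: matrix_vector_mult_diff_distrib)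
    then show "u = w"
      using assms unfolding pos_def_def by (metis eq_iff_diff_eq_0 less_irrefl)
  qed
  then have "\<exists>A'. B ** A' = mat 1 \<and> A' ** B = mat 1"
    using matrix_left_invertible_injective invertible_left_inverse
    unfolding invertible_def by blast
  then have "B ** matrix_inv B = mat 1"
    unfolding matrix_inv_def by (rule someI2_ex) simp
  then show ?thesis
    by (simp add: matrix_vector_mul_assoc)
qed

lemma pos_def_min_eig_nonneg:
  assumes "pos_def B"
  shows "min_eig_nonneg B"
  unfolding min_eig_nonneg_def
proof (intro allI impI, elim conjE)
  fix e v assume v: "v \<noteq> 0" "B *v v = e *\<^sub>R v"
  then have "0 < e * (v \<bullet> v)"
    using assms unfolding pos_def_def by (metis inner_scaleR_right)
  then show "0 \<le> e"
    using inner_ge_zero[of v] by (auto simp: zero_less_mult_iff)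
qed

lemma cauchy_min_nonneg: "0 \<le> \<delta> \<Longrightarrow> 0 \<le> a \<Longrightarrow> 0 \<le> cauchy_min \<delta> a B"
  unfolding cauchy_min_def mat_norm_def
  by (auto intro!: divide_nonneg_nonneg onorm_pos_le)

text \<open>A bound \<open>M\<close> on the action of \<open>B\<close> dominates
  \<open>mat_norm B\<close>, so dividing by \<open>M\<close> gives a smaller radius. One constant
  can then serve all model matrices near the limit.\<close>

lemma cauchy_min_ge:
  assumes "s \<le> \<delta>" "M > 0" "\<And>v. norm (B *v v) \<le> M * norm v" "s * M \<le> a" "0 \<le> a"
  shows "s \<le> cauchy_min \<delta> a B"
proof -
  have M: "mat_norm B \<le> M"
    unfolding mat_norm_def using assms by (intro onorm_le) auto
  have nn: "0 \<le> mat_norm B"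
    unfolding mat_norm_def by (intro onorm_pos_le) auto
  show ?thesis
  proof (cases "mat_norm B = 0")
    case False
    have "s \<le> a / M" using assms by (simp add: field_simps)
    also have "\<dots> \<le> a / mat_norm B"
      using M nn False assms by (intro divide_left_mono) auto
    finally show ?thesis using assms False by (simp add: cauchy_min_def)
  qed (use assms in \<open>simp add: cauchy_min_def\<close>)
qed

text \<open>Strict differentiability: both points vary, so \<open>G\<close> minus \<open>B\<close>
  is Lipschitz with arbitrarily small constant near \<open>a\<close>. One matrix then serves
  expansions about every nearby point.\<close>

definition has_strict_jacobian ::
    "(real^'n \<Rightarrow> real^'m) \<Rightarrow> real^'n^'m \<Rightarrow> real^'n \<Rightarrow> bool" where
  "has_strict_jacobian G B a \<longleftrightarrow> (\<forall>e>0. \<exists>r>0. \<forall>y\<in>ball a r. \<forall>z\<in>ball a r.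
      norm (G z - G y - B *v (z - y)) \<le> e * norm (z - y))"

lemma has_strict_jacobianI:
  fixes G :: "real^'n \<Rightarrow> real^'m"
  assumes "\<And>e. e > 0 \<Longrightarrow> \<exists>r>0. \<forall>y\<in>ball a r. \<exists>D. (G has_derivative D) (at y) \<and>
             (\<forall>h. norm (D h - B *v h) \<le> e * norm h)"
  shows "has_strict_jacobian G B a"
  unfolding has_strict_jacobian_def
proof (intro allI impI)
  fix e :: real assume e: "e > 0"
  obtain r D where r: "r > 0"
    and D: "\<And>y. y \<in> ball a r \<Longrightarrow> (G has_derivative D y) (at y)"
    and DB: "\<And>y h. y \<in> ball a r \<Longrightarrow> norm (D y h - B *v h) \<le> e * norm h"
    using assms[OF e] by metis
  show "\<exists>r>0. \<forall>y\<in>ball a r. \<forall>z\<in>ball a r. norm (G z - G y - B *v (z - y)) \<le> e * norm (z - y)"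
  proof (intro exI[of _ r] conjI ballI)
    fix y z assume yz: "y \<in> ball a r" "z \<in> ball a r"
    have "norm ((G z - B *v z) - (G y - B *v y)) \<le> e * norm (z - y)"
    proof (rule differentiable_bound[of "ball a r" _ "\<lambda>y h. D y h - B *v h"])
      fix w assume w: "w \<in> ball a r"
      show "((\<lambda>y. G y - B *v y) has_derivative (\<lambda>h. D w h - B *v h)) (at w within ball a r)"
        by (intro has_derivative_diff has_derivative_at_withinI[OF D[OF w]]
            bounded_linear_imp_has_derivative matrix_vector_mul_bounded_linear)
      show "onorm (\<lambda>h. D w h - B *v h) \<le> e"
        using DB[OF w] e by (intro onorm_le) auto
    qed (use yz in auto)
    then show "norm (G z - G y - B *v (z - y)) \<le> e * norm (z - y)"
      by (simp add: matrix_vector_mult_diff_distrib algebra_simps)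
  qed (rule r)
qed

lemma strict_jacobian_taylor:
  fixes G :: "real^'n \<Rightarrow> real^'n"
  assumes der: "\<And>y. y \<in> ball a r \<Longrightarrow> (F has_derivative (\<lambda>h. G y \<bullet> h)) (at y)"
    and strict: "\<forall>y\<in>ball a r. \<forall>z\<in>ball a r. norm (G z - G y - B *v (z - y)) \<le> e * norm (z - y)"
    and e: "0 \<le> e" and x: "x \<in> ball a r" and xd: "x + d \<in> ball a r"
  shows "\<bar>F (x + d) - F x - G x \<bullet> d - (d \<bullet> (B *v d)) / 2\<bar> \<le> e * (norm d)\<^sup>2"
proof -
  have seg: "x + t *\<^sub>R d \<in> ball a r" if "0 \<le> t" "t \<le> 1" for t
    using convexD_alt[OF convex_ball x xd that] by (simp add: algebra_simps)
  show ?thesis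
  proof (rule second_order_taylor_bound)
    fix t :: real assume t: "0 \<le> t" "t \<le> 1"
    show "(F has_derivative (\<lambda>h. G (x + t *\<^sub>R d) \<bullet> h)) (at (x + t *\<^sub>R d))"
      using der seg t by blast
    have "norm (G (x + t *\<^sub>R d) - G x - B *v (x + t *\<^sub>R d - x)) \<le> e * norm (x + t *\<^sub>R d - x)"
      using strict seg[OF t] x by blast
    also have "\<dots> \<le> e * norm d"
      using t e by (intro mult_left_mono) (auto simp: mult_left_le_one_le)
    finally show "norm (G (x + t *\<^sub>R d) - G x - t *\<^sub>R (B *v d)) \<le> e * norm d"
      by (simp add: matrix_vector_mult_scaleR)
  qed
qed

text \<open>The mixed second difference of \<open>F\<close> is symmetric in its two increments.\<close>

lemma strict_jacobian_of_gradient_symmetric: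
  fixes G :: "real^'n \<Rightarrow> real^'n"
  assumes r0: "r0 > 0"
    and der: "\<And>y. y \<in> ball a r0 \<Longrightarrow> (F has_derivative (\<lambda>h. G y \<bullet> h)) (at y)"
    and strict: "has_strict_jacobian G B a"
  shows "(B *v h) \<bullet> k = (B *v k) \<bullet> h"
proof -
  \<comment> \<open>\<open>C\<close> sums the error coefficients of the two orders of expansion;
    after rescaling by \<open>t\<close> both sides of the estimate carry the same factor
    \<open>t\<^sup>2\<close>.\<close>
  define C where "C = 2 * norm h * norm k + 2 * (norm h)\<^sup>2 + 2 * (norm k)\<^sup>2"
  have C: "C \<ge> 0" by (simp add: C_def)
  have main: "\<bar>(B *v h) \<bullet> k - (B *v k) \<bullet> h\<bar> \<le> e * C" if e: "e > 0" for e
  proof -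
    obtain r1 where r1: "r1 > 0" and s1: "\<forall>y\<in>ball a r1. \<forall>z\<in>ball a r1.
        norm (G z - G y - B *v (z - y)) \<le> e * norm (z - y)"
      using strict e unfolding has_strict_jacobian_def by blast
    define r where "r = min r0 r1"
    have r: "r > 0" using r0 r1 by (simp add: r_def)
    have s: "\<forall>y\<in>ball a r. \<forall>z\<in>ball a r. norm (G z - G y - B *v (z - y)) \<le> e * norm (z - y)"
      using s1 by (auto simp: r_def)
    have dr: "\<And>y. y \<in> ball a r \<Longrightarrow> (F has_derivative (\<lambda>h. G y \<bullet> h)) (at y)"
      using der by (auto simp: r_def)
    \<comment> \<open>The factor \<open>t\<close> brings all four corners of the parallelogram into
      the ball; the summand 1 keeps the denominator positive.\<close>
    define t where "t = r / (1 + norm h + norm k)"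
    have t: "t > 0" using r by (auto simp: t_def intro!: divide_pos_pos add_pos_nonneg)
    have tb: "t * norm h + t * norm k < r"
    proof -
      have "t * (1 + norm h + norm k) = r"
        unfolding t_def using norm_ge_zero[of h] norm_ge_zero[of k] by (smt (verit) nonzero_eq_divide_eq)
      then show ?thesis using t by (simp add: algebra_simps)
    qed
    define H K where "H = t *\<^sub>R h" and "K = t *\<^sub>R k"
    have HK: "norm H + norm K < r" using tb t by (simp add: H_def K_def)
    \<comment> \<open>Expanding along \<open>K\<close> from \<open>a + H\<close> and from
      \<open>a\<close>, the quadratic terms cancel and the gradient difference contributes
      \<open>(B *v H) \<bullet> K\<close>.\<close>
    have half: "\<bar>(F (a + H + K) - F (a + H) - F (a + K) + F a) - (B *v H) \<bullet> K\<bar>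
        \<le> e * norm H * norm K + 2 * e * (norm K)\<^sup>2" if HK: "norm H + norm K < r" for H K
    proof -
      have "norm (H + K) < r" "norm (K + H) < r"
        using norm_triangle_ineq[of H K] HK by (simp_all add: add.commute)
      then have "a \<in> ball a r" "a + H \<in> ball a r" "a + K \<in> ball a r" "a + H + K \<in> ball a r"
        using HK r norm_ge_zero[of H] norm_ge_zero[of K] by (auto simp: dist_norm add.assoc
            norm_minus_commute intro: le_less_trans[OF _ HK])
      note m = this
      have 1: "\<bar>F (a + H + K) - F (a + H) - G (a + H) \<bullet> K - (K \<bullet> (B *v K)) / 2\<bar> \<le> e * (norm K)\<^sup>2"
        by (rule strict_jacobian_taylor[OF dr s]) (use e m in auto)
      have 2: "\<bar>F (a + K) - F a - G a \<bullet> K - (K \<bullet> (B *v K)) / 2\<bar> \<le> e * (norm K)\<^sup>2"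
        by (rule strict_jacobian_taylor[OF dr s]) (use e m in auto)
      have "norm (G (a + H) - G a - B *v H) \<le> e * norm H"
        using s[rule_format, OF m(1) m(2)] by simp
      then have "norm (G (a + H) - G a - B *v H) * norm K \<le> e * norm H * norm K"
        by (rule mult_right_mono) simp
      then have "\<bar>(G (a + H) - G a - B *v H) \<bullet> K\<bar> \<le> e * norm H * norm K"
        using Cauchy_Schwarz_ineq2 order_trans by blast
      then have 3: "\<bar>G (a + H) \<bullet> K - G a \<bullet> K - (B *v H) \<bullet> K\<bar> \<le> e * norm H * norm K"
        by (simp add: inner_diff_left)
      show ?thesis using 1 2 3 by linarith
    qed
    have HKb: "\<bar>(B *v H) \<bullet> K - (B *v K) \<bullet> H\<bar>
        \<le> e * (2 * norm H * norm K + 2 * (norm H)\<^sup>2 + 2 * (norm K)\<^sup>2)"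
    proof -
      have "norm K + norm H < r" using HK by simp
      from half[OF HK] half[OF this] show ?thesis
        by (simp add: algebra_simps)
    qed
    have "t\<^sup>2 * \<bar>(B *v h) \<bullet> k - (B *v k) \<bullet> h\<bar> \<le> t\<^sup>2 * (e * C)"
    proof -
      have "(B *v H) \<bullet> K - (B *v K) \<bullet> H = t\<^sup>2 * ((B *v h) \<bullet> k - (B *v k) \<bullet> h)"
        by (simp add: H_def K_def matrix_vector_mult_scaleR power2_eq_square algebra_simps)
      moreover have "2 * norm H * norm K + 2 * (norm H)\<^sup>2 + 2 * (norm K)\<^sup>2 = t\<^sup>2 * C"
        using t by (simp add: H_def K_def C_def power2_eq_square algebra_simps)
      ultimately show ?thesis using HKb by (simp add: abs_mult mult.left_commute)
    qed
    then show ?thesis using t by simp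
  qed
  have "\<bar>(B *v h) \<bullet> k - (B *v k) \<bullet> h\<bar> \<le> 0"
  proof (rule field_le_epsilon)
    fix e :: real assume e: "e > 0"
    have "\<bar>(B *v h) \<bullet> k - (B *v k) \<bullet> h\<bar> \<le> e / (C + 1) * C"
      using main[of "e / (C + 1)"] e C by simp
    also have "\<dots> \<le> e" using C e by (simp add: field_simps)
    finally show "\<bar>(B *v h) \<bullet> k - (B *v k) \<bullet> h\<bar> \<le> 0 + e" by simp
  qed
  then show ?thesis by simp
qed

text \<open>At the stationary point the Taylor expansion bounds the growth by half the quadratic
  form plus \<open>c / 2\<close> times the squared length. Half of the growth survives, doubling
  restores \<open>c\<close>, and homogeneity extends the bound from short vectors to all.\<close>

lemma quadratic_growth_coercive:
  fixes G :: "real^'n \<Rightarrow> real^'n"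
  assumes r0: "r0 > 0" and c: "c > 0"
    and der: "\<And>y. y \<in> ball a r0 \<Longrightarrow> (F has_derivative (\<lambda>h. G y \<bullet> h)) (at y)"
    and strict: "has_strict_jacobian G B a"
    and G0: "G a = 0"
    and growth: "\<And>y. y \<in> ball a r0 \<Longrightarrow> F a + c * (norm (y - a))\<^sup>2 \<le> F y"
  shows "c * (norm v)\<^sup>2 \<le> v \<bullet> (B *v v)"
proof (cases "v = 0")
  case False
  obtain r1 where r1: "r1 > 0" and s1: "\<forall>y\<in>ball a r1. \<forall>z\<in>ball a r1.
      norm (G z - G y - B *v (z - y)) \<le> c / 2 * norm (z - y)"
    using strict c unfolding has_strict_jacobian_def by (meson half_gt_zero)
  define r where "r = min r0 r1"
  have r: "r > 0" using r0 r1 by (simp add: r_def)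
  define t where "t = r / (2 * norm v)"
  have t: "t > 0" using False r by (simp add: t_def)
  define w where "w = t *\<^sub>R v"
  have w: "a + w \<in> ball a r" using False r by (simp add: w_def t_def dist_norm)
  have "\<bar>F (a + w) - F a - G a \<bullet> w - (w \<bullet> (B *v w)) / 2\<bar> \<le> c / 2 * (norm w)\<^sup>2"
    by (rule strict_jacobian_taylor[where r = r]) (use der s1 c w r in \<open>auto simp: r_def\<close>)
  moreover have "F a + c * (norm w)\<^sup>2 \<le> F (a + w)"
    using growth[of "a + w"] w by (simp add: r_def)
  ultimately have "c * (norm w)\<^sup>2 \<le> w \<bullet> (B *v w)"
    using G0 by (simp add: abs_le_iff field_simps)
  then have "t\<^sup>2 * (c * (norm v)\<^sup>2) \<le> t\<^sup>2 * (v \<bullet> (B *v v))"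
    using t by (simp add: w_def matrix_vector_mult_scaleR power_mult_distrib
        power2_eq_square algebra_simps)
  then show ?thesis using t by simp
qed simp

subsection \<open>Local convergence of Newton trust-region iterations\<close>

text \<open>Only local information on \<open>F\<close> near \<open>xs\<close> enters.
  \<open>B_near\<close> is uniform over the indices whose iterate is close to \<open>xs\<close>,
  \<open>no_stop\<close> records what a non-terminating run implies at \<open>xs\<close>, and
  \<open>limit_point\<close> asks for one iterate in each ball.\<close>

locale newton_trust_region =
  fixes F :: "real^'n \<Rightarrow> real" and G :: "real^'n \<Rightarrow> real^'n" and xs :: "real^'n"
    and Bs :: "real^'n^'n" and x d :: "nat \<Rightarrow> real^'n" and \<delta> :: "nat \<Rightarrow> real"
    and B :: "nat \<Rightarrow> real^'n^'n" and pred :: "nat \<Rightarrow> real"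
    and r0 lam \<beta> \<mu>1 \<mu>2 c1 c2 c3 :: real
  assumes r0: "r0 > 0"
    and der: "\<And>y. y \<in> ball xs r0 \<Longrightarrow> (F has_derivative (\<lambda>h. G y \<bullet> h)) (at y)"
    and strict: "has_strict_jacobian G Bs xs"
    and G_xs: "G xs = 0"
    and lam: "lam > 0"
    and coercive: "\<And>v. lam * (norm v)\<^sup>2 \<le> v \<bullet> (Bs *v v)"
    and B_near: "\<And>e. e > 0 \<Longrightarrow> \<exists>r>0. \<forall>k. x k \<in> ball xs r \<longrightarrow>
        (\<forall>v. norm (B k *v v - Bs *v v) \<le> e * norm v)"
    and mu: "0 < \<mu>1" "\<mu>1 < \<mu>2" "\<mu>2 < 1"
    and c: "0 < c1" "0 < c2" "1 < c3"
    and \<beta>: "0 < \<beta>"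
    and \<delta>0: "0 < \<delta> 0"
    and pred_def: "\<And>k. pred k = - (G (x k) \<bullet> d k) - (d k \<bullet> (B k *v d k)) / 2"
    and pred_ge: "\<And>k. \<beta> * norm (G (x k)) * cauchy_min (\<delta> k) (norm (G (x k))) (B k) \<le> pred k"
    and feasible: "\<And>k. norm (d k) \<le> \<delta> k"
    and x_Suc: "\<And>k. x (Suc k) = (if (F (x k) - F (x k + d k)) / pred k < \<mu>1 then x k else x k + d k)"
    and \<delta>_Suc: "\<And>k. \<delta> (Suc k) = (if (F (x k) - F (x k + d k)) / pred k < \<mu>1 then c1 * \<delta> k
        else if (F (x k) - F (x k + d k)) / pred k < \<mu>2 then c2 * \<delta> k else c3 * \<delta> k)"
    and newton: "\<And>k. pos_def (B k) \<Longrightarrow> norm (- (matrix_inv (B k) *v G (x k))) \<le> \<delta> k \<Longrightarrow>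
        d k = - (matrix_inv (B k) *v G (x k))"
    and no_stop: "\<And>k. x k = xs \<Longrightarrow> \<not> pos_def (B k)"
    and limit_point: "\<And>e. e > 0 \<Longrightarrow> \<exists>k. x k \<in> ball xs e"
begin

lemma radius_pos: "0 < \<delta> k"
  by (induction k) (use \<delta>0 c in \<open>auto simp: \<delta>_Suc\<close>)

lemma pred_nonneg: "0 \<le> pred k"
  using pred_ge[of k] cauchy_min_nonneg[OF less_imp_le[OF radius_pos[of k]] norm_ge_zero[of "G (x k)"], of "B k"] \<beta>
  by (smt (verit) mult_nonneg_nonneg norm_ge_zero)

text \<open>An accepted step has positive ratio, hence a positive numerator because
  \<open>pred k\<close> is nonnegative. If \<open>pred k = 0\<close>, the quotient is 0 by
  convention and the step is rejected.\<close>

lemma decrease: "F (x (Suc k)) \<le> F (x k)"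
proof (cases "(F (x k) - F (x k + d k)) / pred k < \<mu>1")
  case False
  then have "0 < (F (x k) - F (x k + d k)) / pred k" using mu by linarith
  then have "0 < F (x k) - F (x k + d k)"
    using pred_nonneg[of k] by (auto simp: zero_less_divide_iff)
  then show ?thesis using False by (simp add: x_Suc)
qed (simp add: x_Suc)

lemma decrease_le: "i \<le> j \<Longrightarrow> F (x j) \<le> F (x i)"
  by (rule lift_Suc_antimono_le[of "\<lambda>k. F (x k)"]) (rule decrease)

text \<open>The summand \<open>lam\<close> makes \<open>K\<close> positive and at least
  \<open>lam\<close>, so errors of size \<open>lam / 4\<close> are absorbed into multiples of
  \<open>K\<close>.\<close>

definition K where "K = norm Bs + lam"

lemma K: "0 < K" "lam \<le> K" "norm (Bs *v v) \<le> K * norm v"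
proof -
  show "0 < K" "lam \<le> K" using lam by (auto simp: K_def add_nonneg_pos)
  have "norm Bs * norm v \<le> K * norm v" using lam by (intro mult_right_mono) (auto simp: K_def)
  then show "norm (Bs *v v) \<le> K * norm v" using norm_matrix_vector_mult_le[of Bs v] by linarith
qed

text \<open>A ball on which the gradient linearization and the model matrices are both accurate to
  \<open>e\<close>; each later estimate picks its own \<open>e\<close>.\<close>

definition near :: "real \<Rightarrow> real \<Rightarrow> bool" where
  "near e r \<longleftrightarrow> 0 < r \<and> r \<le> r0 \<and>
     (\<forall>y\<in>ball xs r. \<forall>z\<in>ball xs r. norm (G z - G y - Bs *v (z - y)) \<le> e * norm (z - y)) \<and>
     (\<forall>k. x k \<in> ball xs r \<longrightarrow> (\<forall>v. norm (B k *v v - Bs *v v) \<le> e * norm v))"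

lemma near_ex:
  assumes "e > 0" obtains r where "near e r"
proof -
  obtain r1 where "r1 > 0" "\<forall>y\<in>ball xs r1. \<forall>z\<in>ball xs r1.
      norm (G z - G y - Bs *v (z - y)) \<le> e * norm (z - y)"
    using strict assms unfolding has_strict_jacobian_def by blast
  moreover obtain r2 where "r2 > 0"
    "\<forall>k. x k \<in> ball xs r2 \<longrightarrow> (\<forall>v. norm (B k *v v - Bs *v v) \<le> e * norm v)"
    using B_near[OF assms] by blast
  ultimately have "near e (min r0 (min r1 r2))"
    using r0 by (auto simp: near_def)
  then show ?thesis by (rule that)
qed

lemma near_mono: "near e r \<Longrightarrow> 0 < r' \<Longrightarrow> r' \<le> r \<Longrightarrow> near e r'"
  unfolding near_def by auto

section \<open>Local estimates at accuracy at most \<open>lam / 4\<close>\<close>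

context
  fixes e r assumes e: "0 < e" "e \<le> lam / 4" and nr: "near e r"
begin

lemma r_pos: "0 < r" using nr by (simp add: near_def)

lemma B_close: "x k \<in> ball xs r \<Longrightarrow> norm (B k *v v - Bs *v v) \<le> e * norm v"
  using nr by (simp add: near_def)

lemma B_coercive:
  assumes "x k \<in> ball xs r"
  shows "lam / 2 * (norm v)\<^sup>2 \<le> v \<bullet> (B k *v v)"
proof -
  have "\<bar>v \<bullet> (B k *v v - Bs *v v)\<bar> \<le> norm v * (e * norm v)"
    using Cauchy_Schwarz_ineq2[of v "B k *v v - Bs *v v"] B_close[OF assms, of v]
    by (meson mult_left_mono norm_ge_zero order_trans)
  moreover have "norm v * (e * norm v) \<le> lam / 4 * (norm v)\<^sup>2"
    using mult_right_mono[OF e(2), of "(norm v)\<^sup>2"] by (simp add: power2_eq_square algebra_simps)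
  ultimately show ?thesis
    using coercive[of v] lam mult_nonneg_nonneg[of "lam" "(norm v)\<^sup>2"] by (simp add: inner_diff_right abs_le_iff)
qed

lemma B_pos_def: "x k \<in> ball xs r \<Longrightarrow> pos_def (B k)"
  unfolding pos_def_def
proof (intro allI impI)
  fix v :: "real^'n" assume "x k \<in> ball xs r" "v \<noteq> 0"
  then have "0 < lam / 2 * (norm v)\<^sup>2" using lam by simp
  then show "0 < v \<bullet> (B k *v v)" using B_coercive[OF \<open>x k \<in> ball xs r\<close>, of v] by linarith
qed

text \<open>An iterate at \<open>xs\<close> would have a positive definite model matrix, contrary to
  \<open>no_stop\<close>. With \<open>G_ne\<close> it follows that the gradient does not vanish at
  nearby iterates.\<close>

lemma x_ne: "x k \<in> ball xs r \<Longrightarrow> x k \<noteq> xs"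
  using B_pos_def no_stop by blast

lemma B_norm_lower:
  assumes "x k \<in> ball xs r"
  shows "lam / 2 * norm v \<le> norm (B k *v v)"
proof (cases "v = 0")
  case False
  have "norm v * (lam / 2 * norm v) \<le> norm v * norm (B k *v v)"
    using B_coercive[OF assms, of v] norm_cauchy_schwarz[of v "B k *v v"]
    by (simp add: power2_eq_square algebra_simps)
  then show ?thesis using False by simp
qed simp

lemma B_norm_upper:
  assumes "x k \<in> ball xs r"
  shows "norm (B k *v v) \<le> 2 * K * norm v"
proof -
  have "norm (B k *v v) \<le> norm (Bs *v v) + norm (B k *v v - Bs *v v)"
    by (rule norm_triangle_sub)
  also have "\<dots> \<le> K * norm v + e * norm v"
    using K(3)[of v] B_close[OF assms, of v] by simp
  also have "\<dots> \<le> K * norm v + K * norm v"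
    using e lam K by (intro add_left_mono mult_right_mono) auto
  finally show ?thesis by (simp add: algebra_simps)
qed

lemma G_close: "y \<in> ball xs r \<Longrightarrow> norm (G y - Bs *v (y - xs)) \<le> e * norm (y - xs)"
  using nr r_pos G_xs unfolding near_def by (metis centre_in_ball diff_zero)

lemma G_upper:
  assumes "y \<in> ball xs r" shows "norm (G y) \<le> 2 * K * norm (y - xs)"
proof -
  have "norm (G y) \<le> norm (Bs *v (y - xs)) + norm (G y - Bs *v (y - xs))"
    by (rule norm_triangle_sub)
  also have "\<dots> \<le> K * norm (y - xs) + e * norm (y - xs)"
    using K(3)[of "y - xs"] G_close[OF assms] by simp
  also have "\<dots> \<le> K * norm (y - xs) + K * norm (y - xs)"
    using e lam K by (intro add_left_mono mult_right_mono) auto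
  finally show ?thesis by (simp add: algebra_simps)
qed

lemma G_ne:
  assumes "y \<in> ball xs r" "y \<noteq> xs" shows "G y \<noteq> 0"
proof
  assume "G y = 0"
  then have "norm (Bs *v (y - xs)) \<le> e * norm (y - xs)" using G_close[OF assms(1)] by simp
  then have "norm (y - xs) * norm (Bs *v (y - xs)) \<le> norm (y - xs) * (e * norm (y - xs))"
    by (intro mult_left_mono) auto
  then have "lam * (norm (y - xs))\<^sup>2 \<le> e * (norm (y - xs))\<^sup>2"
    using coercive[of "y - xs"] norm_cauchy_schwarz[of "y - xs" "Bs *v (y - xs)"]
    by (simp add: power2_eq_square algebra_simps)
  then have "lam \<le> e" using assms by simp
  then show False using e lam by linarith
qed

lemma F_taylor:
  assumes "y \<in> ball xs r" "y + v \<in> ball xs r"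
  shows "\<bar>F (y + v) - F y - G y \<bullet> v - (v \<bullet> (Bs *v v)) / 2\<bar> \<le> e * (norm v)\<^sup>2"
  by (rule strict_jacobian_taylor[where r = r and a = xs])
    (use nr der e assms in \<open>auto simp: near_def\<close>)

text \<open>Together with \<open>F_upper\<close> this makes \<open>F y - F xs\<close> comparable to
  the squared distance, so that decreasing values control distances.\<close>

lemma F_lower:
  assumes "y \<in> ball xs r" shows "lam / 4 * (norm (y - xs))\<^sup>2 \<le> F y - F xs"
proof -
  have "\<bar>F y - F xs - ((y - xs) \<bullet> (Bs *v (y - xs))) / 2\<bar> \<le> e * (norm (y - xs))\<^sup>2"
    using F_taylor[of xs "y - xs"] assms r_pos G_xs by simp
  moreover have "e * (norm (y - xs))\<^sup>2 \<le> lam / 4 * (norm (y - xs))\<^sup>2"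
    by (rule mult_right_mono) (use e in auto)
  ultimately show ?thesis using coercive[of "y - xs"] by (simp add: abs_le_iff)
qed

lemma F_upper:
  assumes "y \<in> ball xs r" shows "F y - F xs \<le> K * (norm (y - xs))\<^sup>2"
proof -
  have "\<bar>F y - F xs - ((y - xs) \<bullet> (Bs *v (y - xs))) / 2\<bar> \<le> e * (norm (y - xs))\<^sup>2"
    using F_taylor[of xs "y - xs"] assms r_pos G_xs by simp
  moreover have "e * (norm (y - xs))\<^sup>2 \<le> K / 2 * (norm (y - xs))\<^sup>2"
    by (rule mult_right_mono) (use e K in auto)
  moreover have "(y - xs) \<bullet> (Bs *v (y - xs)) \<le> norm (y - xs) * (K * norm (y - xs))"
    using norm_cauchy_schwarz[of "y - xs" "Bs *v (y - xs)"] K(3)[of "y - xs"]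
    by (meson mult_left_mono norm_ge_zero order_trans)
  then have "(y - xs) \<bullet> (Bs *v (y - xs)) \<le> K * (norm (y - xs))\<^sup>2"
    by (simp add: power2_eq_square mult.left_commute)
  ultimately show ?thesis by linarith
qed

text \<open>A step that does not increase a coercive quadratic model cannot be long.\<close>

lemma d_le_G:
  assumes "x k \<in> ball xs r" shows "norm (d k) \<le> 4 / lam * norm (G (x k))"
proof (cases "d k = 0")
  case False
  have "lam / 2 * (norm (d k))\<^sup>2 / 2 \<le> - (G (x k) \<bullet> d k)"
    using pred_nonneg[of k] B_coercive[OF assms, of "d k"] by (simp add: pred_def)
  also have "\<dots> \<le> norm (G (x k)) * norm (d k)"
    using Cauchy_Schwarz_ineq2[of "G (x k)" "d k"] by linarith
  finally have "norm (d k) * (lam / 4 * norm (d k)) \<le> norm (d k) * norm (G (x k))"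
    by (simp add: power2_eq_square algebra_simps)
  then have "lam / 4 * norm (d k) \<le> norm (G (x k))" using False by simp
  then show ?thesis using lam by (simp add: field_simps)
qed (use lam in simp)

lemma d_le:
  assumes "x k \<in> ball xs r" shows "norm (d k) \<le> 8 * K / lam * norm (x k - xs)"
proof -
  have "norm (d k) \<le> 4 / lam * norm (G (x k))" by (rule d_le_G[OF assms])
  also have "\<dots> \<le> 4 / lam * (2 * K * norm (x k - xs))"
    using G_upper[OF assms] lam by (intro mult_left_mono) auto
  finally show ?thesis by simp
qed

text \<open>Short steps, monotone values and quadratic growth trap the iterates near \<open>xs\<close>.\<close>

lemma trapped: "\<exists>N. \<forall>k\<ge>N. x k \<in> ball xs r"
proof -
  \<comment> \<open>By \<open>d_le\<close>, one iteration enlarges the distance to \<open>xs\<close>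
    by a factor of at most \<open>C\<close>; \<open>q\<close> is small enough that such a step stays
    within \<open>r\<close>.\<close>
  define C where "C = 1 + 8 * K / lam"
  have C: "C > 1" using K lam by (simp add: C_def)
  define q where "q = r / (2 * C)"
  have q: "0 < q" "q < r" "C * q < r" using r_pos C by (auto simp: q_def field_simps)
  \<comment> \<open>\<open>s\<close> is chosen so that \<open>F_upper\<close> keeps the value at
    \<open>x N\<close> within the level at which \<open>F_lower\<close> forces distance at most
    \<open>q\<close>.\<close>
  define s where "s = min q (q * sqrt (lam / (4 * K)))"
  have s: "0 < s" using q lam K by (simp add: s_def)
  obtain N where N: "x N \<in> ball xs s" using limit_point[OF s] by blast
  have xN: "norm (x N - xs) < s" using N by (simp add: dist_norm norm_minus_commute)
  have FN: "F (x N) - F xs \<le> lam / 4 * q\<^sup>2"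
  proof -
    have "x N \<in> ball xs r" using xN q by (simp add: s_def dist_norm norm_minus_commute)
    then have "F (x N) - F xs \<le> K * (norm (x N - xs))\<^sup>2" by (rule F_upper)
    also have "\<dots> \<le> K * (q * sqrt (lam / (4 * K)))\<^sup>2"
      using xN K by (intro mult_left_mono power_mono) (auto simp: s_def)
    also have "\<dots> = lam / 4 * q\<^sup>2"
      using lam K by (simp add: power_mult_distrib)
    finally show ?thesis .
  qed
  have "norm (x (N + j) - xs) \<le> q" for j
  proof (induction j)
    case 0
    then show ?case using xN by (simp add: s_def)
  next
    case (Suc j)
    let ?k = "N + j"
    have k: "x ?k \<in> ball xs r" using Suc q by (simp add: dist_norm norm_minus_commute)
    have "norm (x (Suc ?k) - xs) \<le> norm (x ?k - xs) + norm (d ?k)"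
      using norm_triangle_ineq[of "x ?k - xs" "d ?k"] by (auto simp: x_Suc algebra_simps)
    also have "\<dots> \<le> C * norm (x ?k - xs)" using d_le[OF k] by (simp add: C_def algebra_simps)
    also have "\<dots> \<le> C * q" using Suc C by (intro mult_left_mono) auto
    also have "\<dots> < r" by (rule q)
    \<comment> \<open>The crude bound \<open>C * q\<close> only places the next iterate in the ball,
      where \<open>F_lower\<close> applies; monotone values then restore the bound
      \<open>q\<close>.\<close>
    finally have "x (Suc ?k) \<in> ball xs r" by (simp add: dist_norm norm_minus_commute)
    then have "lam / 4 * (norm (x (Suc ?k) - xs))\<^sup>2 \<le> F (x (Suc ?k)) - F xs" by (rule F_lower)
    also have "\<dots> \<le> F (x N) - F xs" using decrease_le[of N "Suc ?k"] by simp
    also have "\<dots> \<le> lam / 4 * q\<^sup>2" by (rule FN)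
    finally have "(norm (x (Suc ?k) - xs))\<^sup>2 \<le> q\<^sup>2" using lam by simp
    then show ?case using q by (simp add: power2_le_iff_abs_le)
  qed
  then have "\<forall>k\<ge>N. x k \<in> ball xs r"
    using q by (metis dist_norm dist_commute le_Suc_ex le_less_trans mem_ball)
  then show ?thesis by blast
qed

text \<open>The second bound multiplies a gradient norm of at least
  \<open>lam / 4 * norm (d k)\<close> by a Cauchy radius of at least
  \<open>lam / (8 * K) * norm (d k)\<close>, with \<open>2 * K\<close> bounding \<open>B k\<close>.
  Second-order model errors can then be measured against \<open>pred k\<close>.\<close>

lemma pred_pos:
  assumes k: "x k \<in> ball xs r" shows "0 < pred k"
    and "\<beta> * lam\<^sup>2 / (32 * K) * (norm (d k))\<^sup>2 \<le> pred k"
proof -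
  let ?G = "norm (G (x k))"
  have Gp: "0 < ?G" using G_ne[OF k x_ne[OF k]] by simp
  have "min (\<delta> k) (?G / (2 * K)) \<le> cauchy_min (\<delta> k) ?G (B k)"
    using K Gp by (intro cauchy_min_ge[of _ _ "2 * K"] B_norm_upper[OF k]) (auto simp: min_def field_simps)
  moreover have "0 < min (\<delta> k) (?G / (2 * K))" using Gp radius_pos K by simp
  ultimately have "0 < \<beta> * ?G * cauchy_min (\<delta> k) ?G (B k)"
    using Gp \<beta> by (intro mult_pos_pos) linarith+
  then show "0 < pred k" using pred_ge[of k] by linarith
  have dG: "lam / 4 * norm (d k) \<le> ?G" using d_le_G[OF k] lam by (simp add: field_simps)
  have "lam / (8 * K) * norm (d k) \<le> 1 * norm (d k)"
    using K lam by (intro mult_right_mono) (auto simp: field_simps)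
  then have "lam / (8 * K) * norm (d k) \<le> \<delta> k" using feasible[of k] by linarith
  then have "lam / (8 * K) * norm (d k) \<le> cauchy_min (\<delta> k) ?G (B k)"
    using K(1) Gp dG by (intro cauchy_min_ge[of _ _ "2 * K"] B_norm_upper[OF k]) (auto simp: field_simps)
  then have "\<beta> * (lam / 4 * norm (d k)) * (lam / (8 * K) * norm (d k))
      \<le> \<beta> * ?G * cauchy_min (\<delta> k) ?G (B k)"
    using dG \<beta> lam K Gp by (intro mult_mono) auto
  then show "\<beta> * lam\<^sup>2 / (32 * K) * (norm (d k))\<^sup>2 \<le> pred k"
    using pred_ge[of k] by (simp add: power2_eq_square mult_ac)
qed

text \<open>The Taylor error and the exchange of \<open>Bs\<close> for \<open>B k\<close> together
  cost at most \<open>2 * e\<close> times the squared step; \<open>small\<close> fits this into the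
  fraction \<open>1 - \<mu>2\<close> of \<open>pred k\<close>.\<close>

lemma ratio_ge:
  assumes k: "x k \<in> ball xs r" "x k + d k \<in> ball xs r"
    and small: "2 * e \<le> (1 - \<mu>2) * (\<beta> * lam\<^sup>2 / (32 * K))"
  shows "\<mu>2 \<le> (F (x k) - F (x k + d k)) / pred k"
proof -
  have "\<bar>F (x k + d k) - F (x k) - G (x k) \<bullet> d k - (d k \<bullet> (Bs *v d k)) / 2\<bar> \<le> e * (norm (d k))\<^sup>2"
    by (rule F_taylor[OF k])
  moreover have "\<bar>d k \<bullet> (B k *v d k - Bs *v d k)\<bar> \<le> norm (d k) * (e * norm (d k))"
    using Cauchy_Schwarz_ineq2[of "d k" "B k *v d k - Bs *v d k"] B_close[OF k(1), of "d k"]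
    by (meson mult_left_mono norm_ge_zero order_trans)
  ultimately have "pred k - 2 * e * (norm (d k))\<^sup>2 \<le> F (x k) - F (x k + d k)"
    by (simp add: pred_def inner_diff_right power2_eq_square abs_le_iff algebra_simps)
  moreover have "2 * e * (norm (d k))\<^sup>2 \<le> (1 - \<mu>2) * (\<beta> * lam\<^sup>2 / (32 * K)) * (norm (d k))\<^sup>2"
    using small by (rule mult_right_mono) simp
  moreover have "\<dots> \<le> (1 - \<mu>2) * pred k"
    using mult_left_mono[OF pred_pos(2)[OF k(1)], of "1 - \<mu>2"] mu by (simp add: mult.assoc)
  ultimately have "\<mu>2 * pred k \<le> F (x k) - F (x k + d k)" by (simp add: algebra_simps)
  then show ?thesis using pred_pos(1)[OF k(1)] by (simp add: field_simps)
qed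

lemma newton_step_le:
  assumes k: "x k \<in> ball xs r"
  shows "norm (- (matrix_inv (B k) *v G (x k))) \<le> 4 * K / lam * norm (x k - xs)"
proof -
  have "lam / 2 * norm (matrix_inv (B k) *v G (x k)) \<le> norm (G (x k))"
    using B_norm_lower[OF k, of "matrix_inv (B k) *v G (x k)"] pos_def_matrix_inv[OF B_pos_def[OF k]]
    by simp
  also have "\<dots> \<le> 2 * K * norm (x k - xs)" by (rule G_upper[OF k])
  finally show ?thesis using lam by (simp add: field_simps)
qed

text \<open>Applying \<open>B k\<close> to the new error leaves the difference of two small terms:
  the error of \<open>B k\<close> against \<open>Bs\<close> and the linearization error of
  \<open>G\<close>. The lower bound on \<open>B k\<close> then inverts the estimate.\<close>

lemma newton_contraction:
  assumes k: "x k \<in> ball xs r" and dk: "d k = - (matrix_inv (B k) *v G (x k))"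
  shows "norm (x k + d k - xs) \<le> 4 * e / lam * norm (x k - xs)"
proof -
  have "B k *v (x k + d k - xs) = (B k *v (x k - xs) - Bs *v (x k - xs)) - (G (x k) - Bs *v (x k - xs))"
  proof -
    have "B k *v d k = - G (x k)"
      using pos_def_matrix_inv[OF B_pos_def[OF k]] by (simp add: dk linear_neg[OF matrix_vector_mul_linear])
    moreover have "x k + d k - xs = (x k - xs) + d k" by simp
    ultimately show ?thesis by (simp only: matrix_vector_right_distrib) simp
  qed
  then have "norm (B k *v (x k + d k - xs)) \<le> e * norm (x k - xs) + e * norm (x k - xs)"
    using norm_triangle_ineq4[of "B k *v (x k - xs) - Bs *v (x k - xs)" "G (x k) - Bs *v (x k - xs)"]
      B_close[OF k, of "x k - xs"] G_close[OF k] by simp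
  then have "lam / 2 * norm (x k + d k - xs) \<le> 2 * e * norm (x k - xs)"
    using B_norm_lower[OF k, of "x k + d k - xs"] by simp
  then show ?thesis using lam by (simp add: field_simps)
qed

end

section \<open>Convergence, acceptance of Newton steps and the superlinear rate\<close>

lemma converges: "x \<longlonglongrightarrow> xs"
proof (rule LIMSEQ_I)
  fix s :: real assume s: "s > 0"
  obtain r where r: "near (lam / 4) r" using near_ex[of "lam / 4"] lam by auto
  \<comment> \<open>Accuracy is inherited by smaller balls, so the trapping argument works inside
    any prescribed ball.\<close>
  then have "near (lam / 4) (min r s)" using s by (intro near_mono[OF r]) (auto simp: near_def)
  then obtain N where "\<forall>k\<ge>N. x k \<in> ball xs (min r s)"
    using trapped[of "lam / 4"] lam by fastforce
  then show "\<exists>N. \<forall>k\<ge>N. norm (x k - xs) < s"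
    by (auto simp: dist_norm norm_minus_commute)
qed

lemma eventually_near:
  assumes "r > 0" shows "\<forall>\<^sub>F k in sequentially. x k \<in> ball xs r"
  using topological_tendstoD[OF converges open_ball, of xs r] assms by simp

lemma steps_tendsto: "d \<longlonglongrightarrow> 0"
proof -
  obtain r where r: "near (lam / 4) r" using near_ex[of "lam / 4"] lam by auto
  have "\<forall>\<^sub>F k in sequentially. norm (d k) \<le> 8 * K / lam * norm (x k - xs)"
    using eventually_near[of r]
  proof (rule eventually_mono)
    show "0 < r" using r by (simp add: near_def)
    show "norm (d k) \<le> 8 * K / lam * norm (x k - xs)" if "x k \<in> ball xs r" for k
      using d_le[OF _ _ r that] lam by simp
  qed
  moreover have "(\<lambda>k. 8 * K / lam * norm (x k - xs)) \<longlonglongrightarrow> 0"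
    using converges by (intro tendsto_mult_right_zero tendsto_norm_zero) (simp add: LIM_zero)
  ultimately show ?thesis by (rule Lim_null_comparison)
qed

lemma eventually_very_successful:
  "\<forall>\<^sub>F k in sequentially. \<mu>2 \<le> (F (x k) - F (x k + d k)) / pred k"
proof -
  define \<kappa> where "\<kappa> = (1 - \<mu>2) * (\<beta> * lam\<^sup>2 / (32 * K))"
  define e where "e = min (lam / 4) (\<kappa> / 2)"
  have \<kappa>: "0 < \<kappa>" using lam mu \<beta> K(1) by (simp add: \<kappa>_def)
  have e: "0 < e" "e \<le> lam / 4" "2 * e \<le> (1 - \<mu>2) * (\<beta> * lam\<^sup>2 / (32 * K))"
    unfolding \<kappa>_def[symmetric] using \<kappa> lam by (auto simp: e_def min_def)
  obtain r where r: "near e r" using near_ex[OF e(1)] .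
  then have rp: "r > 0" by (simp add: near_def)
  have "(\<lambda>k. x k + d k) \<longlonglongrightarrow> xs" using tendsto_add[OF converges steps_tendsto] by simp
  then have "\<forall>\<^sub>F k in sequentially. x k + d k \<in> ball xs r"
    using topological_tendstoD[OF _ open_ball, of "\<lambda>k. x k + d k" xs] rp by auto
  with eventually_near[OF rp] show ?thesis
    by eventually_elim (rule ratio_ge[OF e(1,2) r _ _ e(3)])
qed

text \<open>Every late step is very successful, so each multiplies the radius by
  \<open>c3 > 1\<close>. The value 1 is a fixed threshold that the vanishing Newton steps eventually
  undercut.\<close>

lemma eventually_radius_ge_1: "\<forall>\<^sub>F k in sequentially. 1 \<le> \<delta> k"
proof -
  obtain N where N: "\<And>k. k \<ge> N \<Longrightarrow> \<mu>2 \<le> (F (x k) - F (x k + d k)) / pred k"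
    using eventually_very_successful unfolding eventually_sequentially by blast
  have grow: "\<delta> (N + j) = c3 ^ j * \<delta> N" for j
  proof (induction j)
    case (Suc j)
    have "\<delta> (Suc (N + j)) = c3 * \<delta> (N + j)" using N[of "N + j"] mu by (simp add: \<delta>_Suc)
    then show ?case using Suc by simp
  qed simp
  obtain n where n: "1 / \<delta> N < c3 ^ n" using real_arch_pow[OF c(3)] by blast
  have "1 \<le> \<delta> k" if "k \<ge> N + n" for k
  proof -
    have j: "k = N + (k - N)" "k - N \<ge> n" using that by auto
    have "1 / \<delta> N < c3 ^ (k - N)" using n power_increasing[OF j(2), of c3] c by linarith
    then show ?thesis using j(1) grow[of "k - N"] radius_pos[of N] by (simp add: field_simps)
  qed
  then show ?thesis unfolding eventually_sequentially by blast
qed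

text \<open>Newton steps are bounded by a multiple of the distance to \<open>xs\<close>, hence
  eventually shorter than 1 and feasible; the hypothesis \<open>newton\<close> then identifies
  \<open>d k\<close>, and very successful steps are accepted.\<close>

lemma eventually_newton:
  "\<forall>\<^sub>F k in sequentially. pos_def (B k) \<and> norm (- (matrix_inv (B k) *v G (x k))) \<le> \<delta> k \<and>
     d k = - (matrix_inv (B k) *v G (x k)) \<and> \<mu>1 \<le> (F (x k) - F (x k + d k)) / pred k \<and>
     x (Suc k) = x k + d k"
proof -
  obtain r where r: "near (lam / 4) r" using near_ex[of "lam / 4"] lam by auto
  have "(\<lambda>k. 4 * K / lam * norm (x k - xs)) \<longlonglongrightarrow> 0"
    using converges by (intro tendsto_mult_right_zero tendsto_norm_zero) (simp add: LIM_zero)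
  then have "\<forall>\<^sub>F k in sequentially. 4 * K / lam * norm (x k - xs) < 1"
    by (rule order_tendstoD) simp
  moreover have "\<forall>\<^sub>F k in sequentially. x k \<in> ball xs r"
    using r by (intro eventually_near) (simp add: near_def)
  ultimately show ?thesis
    using eventually_radius_ge_1 eventually_very_successful
  proof eventually_elim
    case (elim k)
    have pd: "pos_def (B k)" using B_pos_def[of "lam / 4", OF _ _ r] lam elim by auto
    have le: "norm (- (matrix_inv (B k) *v G (x k))) \<le> \<delta> k"
      using newton_step_le[of "lam / 4", OF _ _ r elim(2)] lam elim by linarith
    show ?case using pd le newton[OF pd le] elim mu by (simp add: x_Suc)
  qed
qed

lemma superlinear: "(\<lambda>k. norm (x (Suc k) - xs)) \<in> o(\<lambda>k. norm (x k - xs))"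
proof (rule landau_o.smallI)
  fix c :: real assume c: "c > 0"
  \<comment> \<open>The second bound brings the contraction factor \<open>4 * e / lam\<close> down
    to at most \<open>c\<close>.\<close>
  define e where "e = min (lam / 4) (c * lam / 4)"
  have e: "0 < e" "e \<le> lam / 4" using c lam by (auto simp: e_def)
  have ec: "4 * e / lam \<le> c" using lam by (simp add: e_def field_simps min_def)
  obtain r where r: "near e r" using near_ex[OF e(1)] .
  then have "\<forall>\<^sub>F k in sequentially. x k \<in> ball xs r"
    by (intro eventually_near) (simp add: near_def)
  with eventually_newton
  show "\<forall>\<^sub>F k in sequentially. norm (norm (x (Suc k) - xs)) \<le> c * norm (norm (x k - xs))"
  proof eventually_elim
    case (elim k)
    have "norm (x k + d k - xs) \<le> 4 * e / lam * norm (x k - xs)"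
      using newton_contraction[OF e r] elim by blast
    also have "\<dots> \<le> c * norm (x k - xs)" using ec by (rule mult_right_mono) simp
    finally show ?case using elim by simp
  qed
qed

end

subsection \<open>Proximal map and forward-backward envelope\<close>

lemma tendsto_matrix_matrix_mult:
  fixes A :: "'a \<Rightarrow> real^'n^'m" and B :: "'a \<Rightarrow> real^'p^'n"
  assumes "(A \<longlongrightarrow> a) net" "(B \<longlongrightarrow> b) net"
  shows "((\<lambda>t. A t ** B t) \<longlongrightarrow> a ** b) net"
  unfolding matrix_matrix_mult_def
  by (intro vec_tendstoI) (simp, intro tendsto_sum tendsto_mult tendsto_vec_nth assms)

lemma tendsto_matrix_blinfun:
  fixes J :: "'a \<Rightarrow> (real^'n) \<Rightarrow>\<^sub>L (real^'m)"
  assumes "(J \<longlongrightarrow> j) net"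
  shows "((\<lambda>t. matrix (blinfun_apply (J t))) \<longlongrightarrow> matrix (blinfun_apply j)) net"
  unfolding matrix_def
  by (intro vec_tendstoI) (simp, intro tendsto_vec_nth blinfun.tendsto assms tendsto_const)

lemma matrix_blinfun_works: "matrix (blinfun_apply J) *v h = blinfun_apply J h"
  for J :: "(real^'n) \<Rightarrow>\<^sub>L (real^'m)"
  using fun_cong[OF matrix_vector_mul(2)[of "blinfun_apply J"], of h]
  by (simp add: blinfun.bounded_linear_right bounded_linear.linear)

text \<open>Uniqueness of the derivative identifies the approximating Jacobians with
  \<open>J\<close>, whose continuity leaves one possible limit; a singleton is convex, so the hull
  adds nothing.\<close>

lemma clarke_jac_continuously_differentiable:
  fixes F :: "real^'n \<Rightarrow> real^'n"
  assumes S: "open S" "z \<in> S"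
    and der: "\<And>y. y \<in> S \<Longrightarrow> (F has_derivative blinfun_apply (J y)) (at y)"
    and cont: "continuous_on S J"
    and P: "P \<in> clarke_jac F z"
  shows "P = matrix (blinfun_apply (J z))"
proof -
  have "M = matrix (blinfun_apply (J z))"
    if s: "s \<longlonglongrightarrow> z" and M: "D \<longlonglongrightarrow> M" and D: "\<forall>k. (F has_derivative (\<lambda>h. D k *v h)) (at (s k))"
    for s D M
  proof -
    have "\<forall>\<^sub>F k in sequentially. s k \<in> S" using topological_tendstoD[OF s S] .
    then have "\<forall>\<^sub>F k in sequentially. matrix (blinfun_apply (J (s k))) = D k"
    proof eventually_elim
      case (elim k)
      have "blinfun_apply (J (s k)) = (\<lambda>h. D k *v h)"
        using has_derivative_unique[OF der[OF elim]] D by blast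
      then show ?case by (simp add: matrix_of_matrix_vector_mul)
    qed
    moreover have "(\<lambda>k. J (s k)) \<longlonglongrightarrow> J z"
      using continuous_on_eq_continuous_at[OF S(1)] cont S(2) s isCont_tendsto_compose by blast
    ultimately have "D \<longlonglongrightarrow> matrix (blinfun_apply (J z))"
      using tendsto_matrix_blinfun tendsto_cong by fast
    then show ?thesis using M LIMSEQ_unique by blast
  qed
  then have "clarke_jac F z \<subseteq> {matrix (blinfun_apply (J z))}"
    unfolding clarke_jac_def by (intro hull_minimal) auto
  then show ?thesis using P by blast
qed

text \<open>The direct method: a minimizing sequence is bounded, a subsequence converges, and lower
  semicontinuity makes its limit a minimizer.\<close>

lemma lsc_fun_attains_inf:
  fixes h :: "'a::heine_borel \<Rightarrow> ereal" and q :: "'a \<Rightarrow> real"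
  assumes lsc: "lsc_fun h" and q: "continuous_on UNIV q"
    and ne: "h u \<noteq> \<infinity>"
    and low: "\<And>w. ereal m \<le> h w + ereal (q w)"
    and bdd: "\<And>c::real. bounded {w. h w + ereal (q w) \<le> ereal c}"
  shows "\<exists>w. \<forall>v. h w + ereal (q w) \<le> h v + ereal (q v)"
proof -
  define I where "I = (INF w. h w + ereal (q w))"
  have "ereal m \<le> I" unfolding I_def using low by (intro INF_greatest)
  moreover have "I \<le> h u + ereal (q u)" unfolding I_def by (rule INF_lower) simp
  moreover have "h u + ereal (q u) \<noteq> \<infinity>" using ne by simp
  ultimately obtain i where i: "I = ereal i"
    by (cases I) auto
  have "\<exists>w. h w + ereal (q w) < ereal (i + 1 / Suc n)" for n
  proof -
    have "I < ereal (i + 1 / Suc n)" by (simp add: i)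
    then show ?thesis unfolding I_def INF_less_iff by blast
  qed
  then obtain w where w: "\<And>n. h (w n) + ereal (q (w n)) < ereal (i + 1 / Suc n)" by metis
  have "range w \<subseteq> {w. h w + ereal (q w) \<le> ereal (i + 1)}"
  proof safe
    fix n
    have "ereal (i + 1 / Suc n) \<le> ereal (i + 1)" by simp
    then show "h (w n) + ereal (q (w n)) \<le> ereal (i + 1)" using w[of n] by (meson less_imp_le order_trans)
  qed
  then have "bounded (range w)" using bdd bounded_subset by blast
  then obtain v r where r: "strict_mono r" and v: "(w \<circ> r) \<longlonglongrightarrow> v"
    using bounded_imp_convergent_subsequence by blast
  have "h v + ereal (q v) \<le> ereal i"
  proof (rule ccontr)
    assume "\<not> ?thesis"
    then have "ereal (i - q v) < h v" by (cases "h v") auto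
    then obtain c' where "ereal (i - q v) < c'" "c' < h v" using dense by blast
    then obtain c where c: "i - q v < c" "ereal c < h v" by (cases c') auto
    have "\<forall>\<^sub>F y in at v. ereal c < h y"
      using lsc c(2) unfolding lsc_fun_def le_Liminf_iff by blast
    \<comment> \<open>\<open>lsc_fun\<close> speaks of the punctured limit; the point
      \<open>v\<close> itself is added because the sequence may hit it.\<close>
    then have "\<forall>\<^sub>F y in nhds v. ereal c < h y"
      unfolding eventually_at_filter using c(2) by (auto elim!: eventually_mono)
    then have "\<forall>\<^sub>F n in sequentially. ereal c < h ((w \<circ> r) n)"
      using v filterlim_iff by blast
    then have "\<forall>\<^sub>F n in sequentially. c + q ((w \<circ> r) n) \<le> i + 1 / Suc (r n)"
    proof eventually_elim
      case (elim n)
      then show ?case using w[of "r n"] by (cases "h (w (r n))") auto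
    qed
    moreover have "(\<lambda>n. c + q ((w \<circ> r) n)) \<longlonglongrightarrow> c + q v"
      using q v by (intro tendsto_intros isCont_tendsto_compose[where g = q])
        (auto simp: continuous_on_eq_continuous_at comp_def)
    moreover have "(\<lambda>n. i + 1 / Suc (r n)) \<longlonglongrightarrow> i + 0"
      using LIMSEQ_subseq_LIMSEQ[OF lim_1_over_n[THEN LIMSEQ_Suc] r]
      by (intro tendsto_add tendsto_const) (simp add: comp_def)
    ultimately have "c + q v \<le> i + 0" using tendsto_le[OF sequentially_bot] by blast
    then show False using c by simp
  qed
  moreover have "ereal i \<le> h u' + ereal (q u')" for u'
    unfolding i[symmetric] I_def by (rule INF_lower) simp
  ultimately show ?thesis using order_trans by blast
qed

text \<open>The bound \<open>\<gamma> < 1 / (4 * L)\<close> gives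
  \<open>1 / (2 * \<gamma>) > 2 * L\<close>, enough to absorb linearization errors of
  \<open>f\<close> and still keep \<open>L\<close> times the squared distance. The bound on
  \<open>\<gamma> * \<rho>\<close> makes the proximal objective strongly convex.\<close>

locale forward_backward =
  fixes f :: "real^'n \<Rightarrow> real" and gradf :: "real^'n \<Rightarrow> real^'n"
    and hessf :: "real^'n \<Rightarrow> real^'n^'n" and g :: "real^'n \<Rightarrow> ereal" and L \<rho> \<gamma> :: real
  assumes f_grad: "\<And>x. (f has_derivative (\<lambda>h. gradf x \<bullet> h)) (at x)"
    and f_hess: "\<And>x. (gradf has_derivative (\<lambda>h. hessf x *v h)) (at x)"
    and hess_cont: "\<And>x. isCont hessf x"
    and L_pos: "L > 0"
    and grad_lip: "\<And>x y. norm (gradf x - gradf y) \<le> L * norm (x - y)"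
    and g_proper: "proper_fun g" and g_lsc: "lsc_fun g" and g_wc: "weakly_convex \<rho> g"
    and argmin_ne: "\<exists>z. \<forall>y. ereal (f z) + g z \<le> ereal (f y) + g y"
    and \<gamma>_pos: "0 < \<gamma>" and \<gamma>_L: "\<gamma> < 1 / (4 * L)" and \<gamma>_\<rho>: "\<gamma> * \<rho> < 1"
begin

lemma inv_\<gamma>: "2 * L < 1 / (2 * \<gamma>)"
  using \<gamma>_pos \<gamma>_L L_pos by (simp add: field_simps)

text \<open>The Taylor bound with \<open>w = 0\<close>; the constant is \<open>L\<close> rather than
  \<open>L / 2\<close> because the gradient error is bounded uniformly along the segment.\<close>

lemma f_linearization: "\<bar>f y - f x - gradf x \<bullet> (y - x)\<bar> \<le> L * (norm (y - x))\<^sup>2"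
proof -
  have "\<bar>f (x + (y - x)) - f x - gradf x \<bullet> (y - x) - ((y - x) \<bullet> 0) / 2\<bar> \<le> L * (norm (y - x))\<^sup>2"
  proof (rule second_order_taylor_bound)
    fix t :: real assume t: "0 \<le> t" "t \<le> 1"
    have "norm (gradf (x + t *\<^sub>R (y - x)) - gradf x) \<le> L * norm (t *\<^sub>R (y - x))"
      using grad_lip[of "x + t *\<^sub>R (y - x)" x] by simp
    also have "\<dots> \<le> L * norm (y - x)"
      using t L_pos by (intro mult_left_mono) (auto simp: mult_left_le_one_le)
    finally show "norm (gradf (x + t *\<^sub>R (y - x)) - gradf x - t *\<^sub>R 0) \<le> L * norm (y - x)" by simp
  qed (rule f_grad)
  then show ?thesis by simp
qed

text \<open>A continuous Hessian is a strict derivative of the gradient, so the symmetry of mixed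
  second differences applies. It later moves \<open>Qmat\<close> across the inner product.\<close>

lemma hess_symmetric: "(hessf x *v h) \<bullet> k = (hessf x *v k) \<bullet> h"
proof (rule strict_jacobian_of_gradient_symmetric[of 1 x f gradf])
  show "has_strict_jacobian gradf (hessf x) x"
  proof (rule has_strict_jacobianI)
    fix e :: real assume "e > 0"
    then obtain r where r: "r > 0" "\<And>y. dist y x < r \<Longrightarrow> dist (hessf y) (hessf x) < e"
      using hess_cont[of x] unfolding continuous_at_eps_delta by blast
    have "norm (hessf y *v h - hessf x *v h) \<le> e * norm h" if "y \<in> ball x r" for y h
    proof -
      have "norm (hessf y *v h - hessf x *v h) \<le> norm (hessf y - hessf x) * norm h"
        unfolding matrix_vector_mult_diff_rdistrib[symmetric] by (rule norm_matrix_vector_mult_le)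
      also have "\<dots> \<le> e * norm h"
        using r(2)[of y] that by (intro mult_right_mono) (auto simp: dist_norm norm_minus_commute)
      finally show ?thesis .
    qed
    then show "\<exists>r>0. \<forall>y\<in>ball x r. \<exists>D. (gradf has_derivative D) (at y) \<and>
        (\<forall>h. norm (D h - hessf x *v h) \<le> e * norm h)"
      using f_hess r(1) by blast
  qed
qed (auto intro: f_grad)

section \<open>Existence and uniqueness of the proximal point\<close>

lemma g_not_MInf: "g w \<noteq> -\<infinity>"
  using g_proper by (simp add: proper_fun_def)

text \<open>Since \<open>f + g\<close> attains its infimum, \<open>g\<close> is at least that value
  minus \<open>f\<close>, and \<open>f\<close> lies below a quadratic.\<close>

lemma g_lower: "\<exists>m. \<forall>y. ereal (m - gradf z \<bullet> (y - z) - L * (norm (y - z))\<^sup>2) \<le> g y"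
proof -
  obtain a where a: "\<And>y. ereal (f a) + g a \<le> ereal (f y) + g y" using argmin_ne by blast
  obtain b where b: "g b \<noteq> \<infinity>" using g_proper by (auto simp: proper_fun_def)
  have "g a \<noteq> \<infinity>" using a[of b] b by auto
  then obtain ga where ga: "g a = ereal ga" using g_not_MInf[of a] by (cases "g a") auto
  have "ereal (f a + ga - f z - gradf z \<bullet> (y - z) - L * (norm (y - z))\<^sup>2) \<le> g y" for y
    using a[of y] ga f_linearization[of y z] by (cases "g y") (auto simp: abs_le_iff)
  then show ?thesis by blast
qed

text \<open>The proximal term outweighs the quadratic in the lower bound on \<open>g\<close> by at
  least \<open>L\<close> times the squared distance, which leaves a coercive bound with
  \<open>a = norm (gradf z)\<close>.\<close>

lemma prox_objective_lower:
  "\<exists>m. \<exists>a\<ge>0. \<forall>w. ereal (m + norm (w - z) * (L * norm (w - z) - a)) \<le> g w + ereal ((norm (w - z))\<^sup>2 / (2 * \<gamma>))"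
proof -
  obtain m where m: "\<And>y. ereal (m - gradf z \<bullet> (y - z) - L * (norm (y - z))\<^sup>2) \<le> g y"
    using g_lower[of z] by blast
  show ?thesis
  proof (rule exI[of _ m], rule exI[of _ "norm (gradf z)"], intro conjI allI)
    fix w
    have "gradf z \<bullet> (w - z) \<le> norm (gradf z) * norm (w - z)" by (rule norm_cauchy_schwarz)
    moreover have "2 * L * (norm (w - z))\<^sup>2 \<le> 1 / (2 * \<gamma>) * (norm (w - z))\<^sup>2"
      using inv_\<gamma> by (intro mult_right_mono) auto
    ultimately have "m + norm (w - z) * (L * norm (w - z) - norm (gradf z))
        \<le> m - gradf z \<bullet> (w - z) - L * (norm (w - z))\<^sup>2 + (norm (w - z))\<^sup>2 / (2 * \<gamma>)"
      by (simp add: power2_eq_square algebra_simps)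
    then show "ereal (m + norm (w - z) * (L * norm (w - z) - norm (gradf z)))
        \<le> g w + ereal ((norm (w - z))\<^sup>2 / (2 * \<gamma>))"
      using m[of w] by (cases "g w") auto
  qed simp
qed

lemma prox_exists:
  "\<exists>w. \<forall>v. g w + ereal ((norm (w - z))\<^sup>2 / (2 * \<gamma>)) \<le> g v + ereal ((norm (v - z))\<^sup>2 / (2 * \<gamma>))"
proof -
  obtain b where b: "g b \<noteq> \<infinity>" using g_proper by (auto simp: proper_fun_def)
  obtain m a where a: "0 \<le> a" and low: "\<And>w. ereal (m + norm (w - z) * (L * norm (w - z) - a))
      \<le> g w + ereal ((norm (w - z))\<^sup>2 / (2 * \<gamma>))"
    using prox_objective_lower[of z] by metis
  show ?thesis
  proof (rule lsc_fun_attains_inf[OF g_lsc _ b])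
    show "continuous_on UNIV (\<lambda>w. (norm (w - z))\<^sup>2 / (2 * \<gamma>))"
      using \<gamma>_pos by (intro continuous_intros) auto
    fix w
    have "0 \<le> (2 * L * norm (w - z) - a)\<^sup>2 / (4 * L)" using L_pos by simp
    also have "\<dots> = norm (w - z) * (L * norm (w - z) - a) + a\<^sup>2 / (4 * L)"
      using L_pos by (simp add: field_simps power2_eq_square)
    finally have "ereal (m - a\<^sup>2 / (4 * L)) \<le> ereal (m + norm (w - z) * (L * norm (w - z) - a))" by simp
    then show "ereal (m - a\<^sup>2 / (4 * L)) \<le> g w + ereal ((norm (w - z))\<^sup>2 / (2 * \<gamma>))"
      using low order_trans by blast
  next
    fix c :: real
    \<comment> \<open>Beyond distance \<open>(a + 1) / L\<close> the lower bound is at least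
      \<open>m\<close> plus the distance, so sublevel sets are bounded.\<close>
    have "norm (w - z) \<le> max ((a + 1) / L) (c - m)"
      if "g w + ereal ((norm (w - z))\<^sup>2 / (2 * \<gamma>)) \<le> ereal c" for w
    proof (cases "norm (w - z) \<le> (a + 1) / L")
      case False
      then have "1 \<le> L * norm (w - z) - a" using L_pos by (simp add: field_simps)
      then have "norm (w - z) * 1 \<le> norm (w - z) * (L * norm (w - z) - a)"
        by (intro mult_left_mono) auto
      moreover have "m + norm (w - z) * (L * norm (w - z) - a) \<le> c"
        using order_trans[OF low that] by simp
      ultimately show ?thesis by simp
    qed simp
    then show "bounded {w. g w + ereal ((norm (w - z))\<^sup>2 / (2 * \<gamma>)) \<le> ereal c}"
      by (intro bounded_subset[OF bounded_cball[of z "max ((a + 1) / L) (c - m)"]])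
        (auto simp: dist_norm norm_minus_commute)
  qed
qed

text \<open>The midpoint of two minimizers is compared with both. The parallelogram identity gains a
  quarter of their squared distance, of which weak convexity can consume only the fraction
  \<open>\<gamma> * \<rho> < 1\<close>.\<close>

lemma prox_unique:
  assumes 1: "\<forall>v. g w1 + ereal ((norm (w1 - z))\<^sup>2 / (2 * \<gamma>)) \<le> g v + ereal ((norm (v - z))\<^sup>2 / (2 * \<gamma>))"
    and 2: "\<forall>v. g w2 + ereal ((norm (w2 - z))\<^sup>2 / (2 * \<gamma>)) \<le> g v + ereal ((norm (v - z))\<^sup>2 / (2 * \<gamma>))"
  shows "w1 = w2"
proof -
  obtain b where b: "g b \<noteq> \<infinity>" using g_proper by (auto simp: proper_fun_def)
  have "g w1 \<noteq> \<infinity>" "g w2 \<noteq> \<infinity>" using 1[rule_format, of b] 2[rule_format, of b] b by auto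
  then obtain g1 g2 where g12: "g w1 = ereal g1" "g w2 = ereal g2"
    using g_not_MInf by (metis ereal_cases)
  define w where "w = (1/2) *\<^sub>R (w1 + w2)"
  have cvx: "g w + ereal (\<rho> / 2 * (norm w)\<^sup>2) \<le>
      ereal (1 - 1/2) * (g w1 + ereal (\<rho> / 2 * (norm w1)\<^sup>2)) + ereal (1/2) * (g w2 + ereal (\<rho> / 2 * (norm w2)\<^sup>2))"
    using g_wc[unfolded weakly_convex_def convex_efun_def, rule_format, of "1/2" w1 w2]
    by (simp add: w_def scaleR_add_right)
  then have "g w \<noteq> \<infinity>" using g12 by auto
  then obtain gw where gw: "g w = ereal gw" using g_not_MInf[of w] by (cases "g w") auto
  have c: "gw + \<rho> / 2 * (norm w)\<^sup>2 \<le> (g1 + \<rho> / 2 * (norm w1)\<^sup>2) / 2 + (g2 + \<rho> / 2 * (norm w2)\<^sup>2) / 2"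
    using cvx by (simp add: g12 gw)
  \<comment> \<open>The centre is left free: \<open>y = z\<close> serves the proximal terms and
    \<open>y = 0\<close> the quadratic of weak convexity.\<close>
  have par: "(norm (w - y))\<^sup>2 = (norm (w1 - y))\<^sup>2 / 2 + (norm (w2 - y))\<^sup>2 / 2 - (norm (w1 - w2))\<^sup>2 / 4" for y
    unfolding w_def power2_norm_eq_inner
    by (simp add: inner_add_left inner_add_right inner_diff_left inner_diff_right inner_commute field_simps)
  have scale: "2 * \<gamma> * p + s \<le> 2 * \<gamma> * q + t" if "p + s / (2 * \<gamma>) \<le> q + t / (2 * \<gamma>)" for p q s t
    using mult_left_mono[OF that, of "2 * \<gamma>"] \<gamma>_pos by (simp add: distrib_left)
  have "g1 + (norm (w1 - z))\<^sup>2 / (2 * \<gamma>) \<le> gw + (norm (w - z))\<^sup>2 / (2 * \<gamma>)"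
    "g2 + (norm (w2 - z))\<^sup>2 / (2 * \<gamma>) \<le> gw + (norm (w - z))\<^sup>2 / (2 * \<gamma>)"
    using 1[rule_format, of w] 2[rule_format, of w] by (auto simp: g12 gw)
  then have "2 * \<gamma> * g1 + (norm (w1 - z))\<^sup>2 \<le> 2 * \<gamma> * gw + (norm (w - z))\<^sup>2"
    "2 * \<gamma> * g2 + (norm (w2 - z))\<^sup>2 \<le> 2 * \<gamma> * gw + (norm (w - z))\<^sup>2"
    using scale by blast+
  moreover have "2 * \<gamma> * gw + \<gamma> * \<rho> * (norm w)\<^sup>2
      \<le> 2 * \<gamma> * g1 / 2 + 2 * \<gamma> * g2 / 2 + \<gamma> * \<rho> * (norm w1)\<^sup>2 / 2 + \<gamma> * \<rho> * (norm w2)\<^sup>2 / 2"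
    using mult_left_mono[OF c, of "2 * \<gamma>"] \<gamma>_pos by (simp add: field_simps)
  ultimately have "(norm (w1 - w2))\<^sup>2 / 4 \<le> \<gamma> * \<rho> * (norm w1)\<^sup>2 / 2 + \<gamma> * \<rho> * (norm w2)\<^sup>2 / 2 - \<gamma> * \<rho> * (norm w)\<^sup>2"
    using par[of z] by linarith
  also have "\<dots> = \<gamma> * \<rho> * ((norm w1)\<^sup>2 / 2 + (norm w2)\<^sup>2 / 2 - (norm w)\<^sup>2)"
    by (simp add: algebra_simps)
  also have "(norm w1)\<^sup>2 / 2 + (norm w2)\<^sup>2 / 2 - (norm w)\<^sup>2 = (norm (w1 - w2))\<^sup>2 / 4"
    using par[of 0] by simp
  finally have "(norm (w1 - w2))\<^sup>2 / 4 \<le> \<gamma> * \<rho> * ((norm (w1 - w2))\<^sup>2 / 4)" .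
  then have "(1 - \<gamma> * \<rho>) * (norm (w1 - w2))\<^sup>2 \<le> 0" by (simp add: algebra_simps)
  then have "(norm (w1 - w2))\<^sup>2 \<le> 0" using \<gamma>_\<rho> by (simp add: mult_le_0_iff)
  then show ?thesis by simp
qed

lemma prox_minimizes:
  "g (prox \<gamma> g z) + ereal ((norm (prox \<gamma> g z - z))\<^sup>2 / (2 * \<gamma>)) \<le> g v + ereal ((norm (v - z))\<^sup>2 / (2 * \<gamma>))"
proof -
  have "\<exists>!w. \<forall>v. g w + ereal ((norm (w - z))\<^sup>2 / (2 * \<gamma>)) \<le> g v + ereal ((norm (v - z))\<^sup>2 / (2 * \<gamma>))"
    using prox_exists[of z] prox_unique by blast
  from theI'[OF this] show ?thesis unfolding prox_def by blast
qed

section \<open>The Moreau envelope and its gradient\<close>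

definition g_prox where "g_prox z = real_of_ereal (g (prox \<gamma> g z))"

lemma g_prox: "g (prox \<gamma> g z) = ereal (g_prox z)"
proof -
  obtain b where "g b \<noteq> \<infinity>" using g_proper by (auto simp: proper_fun_def)
  then have "g (prox \<gamma> g z) \<noteq> \<infinity>" using prox_minimizes[of z b] by auto
  then show ?thesis using g_not_MInf unfolding g_prox_def by (cases "g (prox \<gamma> g z)") auto
qed

text \<open>The Moreau envelope of \<open>g\<close> with parameter \<open>\<gamma>\<close>, written
  as its attained value.\<close>

definition env where "env z = g_prox z + (norm (prox \<gamma> g z - z))\<^sup>2 / (2 * \<gamma>)"

lemma env_le: "env y \<le> g_prox z + (norm (prox \<gamma> g z - y))\<^sup>2 / (2 * \<gamma>)"
  using prox_minimizes[of y "prox \<gamma> g z"] by (simp add: g_prox env_def)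

text \<open>The proximal point of \<open>z\<close> is a competitor at \<open>y\<close>; expanding
  the square about \<open>z\<close> gives the bound.\<close>

lemma env_diff_le:
  "env y - env z \<le> (1 / \<gamma>) * ((z - prox \<gamma> g z) \<bullet> (y - z)) + (norm (y - z))\<^sup>2 / (2 * \<gamma>)"
proof -
  let ?p = "prox \<gamma> g z"
  have "(norm (?p - y))\<^sup>2 = (norm (?p - z))\<^sup>2 + 2 * ((z - ?p) \<bullet> (y - z)) + (norm (y - z))\<^sup>2"
    unfolding power2_norm_eq_inner
    by (simp add: inner_diff_left inner_diff_right inner_commute algebra_simps)
  then have "(norm (?p - y))\<^sup>2 / (2 * \<gamma>)
      = (norm (?p - z))\<^sup>2 / (2 * \<gamma>) + (1 / \<gamma>) * ((z - ?p) \<bullet> (y - z)) + (norm (y - z))\<^sup>2 / (2 * \<gamma>)"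
    by (simp add: add_divide_distrib)
  then show ?thesis using env_le[of y z] unfolding env_def by linarith
qed

text \<open>\<open>env_diff_le\<close> in both orders of its arguments bounds the increment through
  the slopes at \<open>y\<close> and at \<open>z\<close>; these approach each other by continuity of
  \<open>prox\<close>.\<close>

lemma env_has_derivative:
  assumes cont: "isCont (prox \<gamma> g) z"
  shows "(env has_derivative (\<lambda>h. ((1 / \<gamma>) *\<^sub>R (z - prox \<gamma> g z)) \<bullet> h)) (at z)"
proof (rule has_derivativeI_sandwich[of 1])
  define D where "D y = (1 / \<gamma>) *\<^sub>R (y - prox \<gamma> g y)" for y
  have sw: "norm (env y - env z - D z \<bullet> (y - z)) / norm (y - z)
      \<le> norm (D y - D z) + norm (y - z) / (2 * \<gamma>)" if "y \<noteq> z" for y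
  proof -
    have "env y - env z - D z \<bullet> (y - z) \<le> (norm (y - z))\<^sup>2 / (2 * \<gamma>)"
      using env_diff_le[of y z] by (simp add: D_def)
    moreover have "- ((norm (y - z))\<^sup>2 / (2 * \<gamma>)) \<le> env y - env z - D y \<bullet> (y - z)"
    proof -
      have "D y \<bullet> (z - y) = - (D y \<bullet> (y - z))" by (simp add: inner_diff_right)
      then show ?thesis using env_diff_le[of z y] by (simp add: D_def norm_minus_commute)
    qed
    moreover have "\<bar>(D y - D z) \<bullet> (y - z)\<bar> \<le> norm (D y - D z) * norm (y - z)"
      by (rule Cauchy_Schwarz_ineq2)
    ultimately have "\<bar>env y - env z - D z \<bullet> (y - z)\<bar>
        \<le> norm (D y - D z) * norm (y - z) + (norm (y - z))\<^sup>2 / (2 * \<gamma>)"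
      by (simp add: inner_diff_left abs_le_iff)
    also have "\<dots> = (norm (D y - D z) + norm (y - z) / (2 * \<gamma>)) * norm (y - z)"
      by (simp add: power2_eq_square algebra_simps)
    finally show ?thesis using that by (simp add: divide_le_eq)
  qed
  show "norm (env y - env z - ((1 / \<gamma>) *\<^sub>R (z - prox \<gamma> g z)) \<bullet> (y - z)) / norm (y - z)
      \<le> norm (D y - D z) + norm (y - z) / (2 * \<gamma>)" if "y \<noteq> z" for y
    using sw[OF that] by (simp add: D_def)
  have "isCont D z" unfolding D_def using cont by (intro continuous_intros)
  then have "((\<lambda>y. norm (D y - D z) + norm (y - z) / (2 * \<gamma>))
      \<longlongrightarrow> norm (D z - D z) + norm (z - z) / (2 * \<gamma>)) (at z)"
    using \<gamma>_pos by (intro tendsto_intros) (auto simp: isCont_def)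
  then show "((\<lambda>y. norm (D y - D z) + norm (y - z) / (2 * \<gamma>)) \<longlongrightarrow> 0) (at z)" by simp
qed (auto intro: bounded_linear_inner_right simp del: inner_scaleR_left)

section \<open>The forward step and the forward-backward envelope\<close>

definition Z where "Z x = x - \<gamma> *\<^sub>R gradf x"

lemma fb_op_eq: "fb_op \<gamma> gradf g x = prox \<gamma> g (Z x)"
  by (simp add: fb_op_def Z_def)

lemma fb_res_eq: "fb_res \<gamma> gradf g x = (1 / \<gamma>) *\<^sub>R (x - prox \<gamma> g (Z x))"
  by (simp add: fb_res_def fb_op_eq)

text \<open>Completing the square turns the forward-backward envelope into a Moreau envelope.\<close>

lemma fbe_eq: "fbe \<gamma> f gradf g x = f x - \<gamma> / 2 * (norm (gradf x))\<^sup>2 + env (Z x)"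
proof -
  let ?c = "f x - \<gamma> / 2 * (norm (gradf x))\<^sup>2"
  have sq: "f x + gradf x \<bullet> (u - x) + (norm (u - x))\<^sup>2 / (2 * \<gamma>) = ?c + (norm (u - Z x))\<^sup>2 / (2 * \<gamma>)" for u
  proof -
    have "(norm (u - Z x))\<^sup>2 = (norm (u - x))\<^sup>2 + 2 * \<gamma> * (gradf x \<bullet> (u - x)) + \<gamma>\<^sup>2 * (norm (gradf x))\<^sup>2"
      unfolding power2_norm_eq_inner Z_def
      by (simp add: inner_diff_left inner_diff_right inner_commute algebra_simps power2_eq_square)
    then show ?thesis using \<gamma>_pos by (simp add: field_simps power2_eq_square)
  qed
  have obj: "ereal (f x + gradf x \<bullet> (u - x)) + g u + ereal ((norm (u - x))\<^sup>2 / (2 * \<gamma>))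
      = ereal ?c + (g u + ereal ((norm (u - Z x))\<^sup>2 / (2 * \<gamma>)))" for u
    using sq[of u] by (cases "g u") auto
  have "(INF u. ereal ?c + (g u + ereal ((norm (u - Z x))\<^sup>2 / (2 * \<gamma>)))) = ereal (?c + env (Z x))"
  proof (rule antisym)
    show "(INF u. ereal ?c + (g u + ereal ((norm (u - Z x))\<^sup>2 / (2 * \<gamma>)))) \<le> ereal (?c + env (Z x))"
      by (rule INF_lower2[of "prox \<gamma> g (Z x)"]) (auto simp: g_prox env_def)
    show "ereal (?c + env (Z x)) \<le> (INF u. ereal ?c + (g u + ereal ((norm (u - Z x))\<^sup>2 / (2 * \<gamma>))))"
    proof (rule INF_greatest)
      fix u
      have "ereal (env (Z x)) \<le> g u + ereal ((norm (u - Z x))\<^sup>2 / (2 * \<gamma>))"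
        using prox_minimizes[of "Z x" u] by (simp add: g_prox env_def)
      from add_left_mono[OF this, of "ereal ?c"]
      show "ereal (?c + env (Z x)) \<le> ereal ?c + (g u + ereal ((norm (u - Z x))\<^sup>2 / (2 * \<gamma>)))"
        by simp
    qed
  qed
  then show ?thesis unfolding fbe_def obj by simp
qed

text \<open>At the proximal point the envelope is linearized \<open>f\<close> plus \<open>g\<close>
  plus the proximal term. The latter has weight above \<open>2 * L\<close>, the linearization costs
  \<open>L\<close>, and \<open>L\<close> remains.\<close>

lemma fbe_lower:
  "f (prox \<gamma> g (Z x)) + g_prox (Z x) + L * (norm (prox \<gamma> g (Z x) - x))\<^sup>2 \<le> fbe \<gamma> f gradf g x"
proof -
  let ?T = "prox \<gamma> g (Z x)"
  have "(norm (?T - Z x))\<^sup>2 = (norm (?T - x))\<^sup>2 + 2 * \<gamma> * (gradf x \<bullet> (?T - x)) + \<gamma>\<^sup>2 * (norm (gradf x))\<^sup>2"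
    unfolding power2_norm_eq_inner Z_def
    by (simp add: inner_diff_left inner_diff_right inner_commute algebra_simps power2_eq_square)
  then have "fbe \<gamma> f gradf g x = f x + gradf x \<bullet> (?T - x) + g_prox (Z x) + (norm (?T - x))\<^sup>2 / (2 * \<gamma>)"
    unfolding fbe_eq env_def using \<gamma>_pos by (simp add: field_simps power2_eq_square)
  moreover have "2 * L * (norm (?T - x))\<^sup>2 \<le> 1 / (2 * \<gamma>) * (norm (?T - x))\<^sup>2"
    using inv_\<gamma> by (intro mult_right_mono) auto
  ultimately show ?thesis using f_linearization[of ?T x] by (simp add: abs_le_iff)
qed

lemma Z_has_derivative: "(Z has_derivative (\<lambda>h. Qmat \<gamma> hessf x *v h)) (at x)"
  unfolding Z_def Qmat_def
  by (auto intro!: derivative_eq_intros f_hess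
      simp: matrix_vector_mult_diff_rdistrib scaleR_matrix_vector_assoc)

lemma Z_isCont: "isCont Z x"
  using Z_has_derivative has_derivative_continuous by blast

text \<open>The chain rule on \<open>fbe_eq\<close>. The Moreau gradient at \<open>Z x\<close> is
  the residual minus \<open>gradf x\<close>; the second part cancels the explicit gradient terms,
  and symmetry of the Hessian moves \<open>Qmat\<close> to the residual.\<close>

lemma fbe_has_derivative:
  assumes "isCont (prox \<gamma> g) (Z x)"
  shows "(fbe \<gamma> f gradf g has_derivative (\<lambda>h. (Qmat \<gamma> hessf x *v fb_res \<gamma> gradf g x) \<bullet> h)) (at x)"
proof -
  let ?P = "(1 / \<gamma>) *\<^sub>R (Z x - prox \<gamma> g (Z x))"
  have e: "((\<lambda>x. env (Z x)) has_derivative (\<lambda>h. ?P \<bullet> (Qmat \<gamma> hessf x *v h))) (at x)"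
    using has_derivative_compose[OF Z_has_derivative env_has_derivative[OF assms]] .
  have n: "((\<lambda>x. (norm (gradf x))\<^sup>2) has_derivative (\<lambda>h. 2 * (gradf x \<bullet> (hessf x *v h)))) (at x)"
    unfolding power2_norm_eq_inner
    by (auto intro!: derivative_eq_intros f_hess simp: inner_commute)
  have "((\<lambda>x. f x - \<gamma> / 2 * (norm (gradf x))\<^sup>2 + env (Z x)) has_derivative
      (\<lambda>h. gradf x \<bullet> h - \<gamma> / 2 * (2 * (gradf x \<bullet> (hessf x *v h))) + ?P \<bullet> (Qmat \<gamma> hessf x *v h))) (at x)"
    by (intro has_derivative_add has_derivative_diff has_derivative_mult_right e n f_grad)
  moreover have "gradf x \<bullet> h - \<gamma> / 2 * (2 * (gradf x \<bullet> (hessf x *v h))) + ?P \<bullet> (Qmat \<gamma> hessf x *v h)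
      = (Qmat \<gamma> hessf x *v fb_res \<gamma> gradf g x) \<bullet> h" for h
  proof -
    have Q: "Qmat \<gamma> hessf x *v v = v - \<gamma> *\<^sub>R (hessf x *v v)" for v
      by (simp add: Qmat_def matrix_vector_mult_diff_rdistrib scaleR_matrix_vector_assoc)
    have R: "?P = fb_res \<gamma> gradf g x - gradf x"
      using \<gamma>_pos by (simp add: fb_res_eq Z_def algebra_simps)
    have "gradf x \<bullet> h - \<gamma> / 2 * (2 * (gradf x \<bullet> (hessf x *v h))) + ?P \<bullet> (Qmat \<gamma> hessf x *v h)
        = fb_res \<gamma> gradf g x \<bullet> (Qmat \<gamma> hessf x *v h)"
      unfolding R Q by (simp add: inner_diff_left inner_diff_right algebra_simps)
    also have "\<dots> = (Qmat \<gamma> hessf x *v fb_res \<gamma> gradf g x) \<bullet> h"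
      unfolding Q using hess_symmetric[of x h "fb_res \<gamma> gradf g x"]
      by (simp add: inner_diff_left inner_diff_right inner_commute)
    finally show ?thesis .
  qed
  ultimately show ?thesis by (simp add: fbe_eq[abs_def])
qed

lemma fbe_grad_eq:
  assumes "isCont (prox \<gamma> g) (Z x)"
  shows "fbe_grad \<gamma> f gradf g x = Qmat \<gamma> hessf x *v fb_res \<gamma> gradf g x"
  unfolding fbe_grad_def
proof (rule the_equality)
  show "(fbe \<gamma> f gradf g has_derivative (\<lambda>h. (Qmat \<gamma> hessf x *v fb_res \<gamma> gradf g x) \<bullet> h)) (at x)"
    by (rule fbe_has_derivative[OF assms])
  fix v assume "(fbe \<gamma> f gradf g has_derivative (\<lambda>h. v \<bullet> h)) (at x)"
  from has_derivative_unique[OF this fbe_has_derivative[OF assms]]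
  have "\<forall>h. v \<bullet> h = (Qmat \<gamma> hessf x *v fb_res \<gamma> gradf g x) \<bullet> h"
    by metis
  then show "v = Qmat \<gamma> hessf x *v fb_res \<gamma> gradf g x"
    by (simp only: vector_eq_rdot)
qed

text \<open>With \<open>T = prox \<gamma> g (Z y)\<close>, \<open>fbe_lower\<close> keeps
  \<open>L\<close> times the square of \<open>norm (T - y)\<close>, and strong minimality at
  \<open>T\<close> adds \<open>c\<close> times the square of \<open>norm (T - xs)\<close>. The
  triangle inequality combines both into \<open>min c L / 2\<close>.\<close>

lemma fbe_quadratic_growth:
  assumes fixp: "prox \<gamma> g (Z xs) = xs" and cont: "isCont (prox \<gamma> g) (Z xs)"
    and c: "c > 0" and \<epsilon>: "\<epsilon> > 0"
    and growth: "\<And>y. norm (y - xs) < \<epsilon> \<Longrightarrow>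
      ereal (f xs) + g xs + ereal (c * (norm (y - xs))\<^sup>2) \<le> ereal (f y) + g y"
  shows "\<exists>r>0. \<forall>y\<in>ball xs r.
      fbe \<gamma> f gradf g xs + min c L / 2 * (norm (y - xs))\<^sup>2 \<le> fbe \<gamma> f gradf g y"
proof -
  \<comment> \<open>At a fixed point \<open>xs - Z xs\<close> is \<open>\<gamma>\<close> times the
    gradient, so the proximal term cancels the subtracted gradient term of
    \<open>fbe_eq\<close>.\<close>
  have fx: "fbe \<gamma> f gradf g xs = f xs + g_prox (Z xs)"
  proof -
    have "xs - Z xs = \<gamma> *\<^sub>R gradf xs" by (simp add: Z_def)
    then have "(norm (xs - Z xs))\<^sup>2 = \<gamma>\<^sup>2 * (norm (gradf xs))\<^sup>2" by (simp add: power_mult_distrib)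
    then show ?thesis using \<gamma>_pos by (simp add: fbe_eq env_def fixp power2_eq_square)
  qed
  have "isCont (\<lambda>y. prox \<gamma> g (Z y)) xs"
    by (rule isCont_o2[OF Z_isCont cont])
  then obtain r where r: "r > 0" "\<And>y. dist y xs < r \<Longrightarrow> dist (prox \<gamma> g (Z y)) xs < \<epsilon>"
    using \<epsilon> fixp unfolding continuous_at_eps_delta by metis
  have "fbe \<gamma> f gradf g xs + min c L / 2 * (norm (y - xs))\<^sup>2 \<le> fbe \<gamma> f gradf g y"
    if y: "y \<in> ball xs r" for y
  proof -
    let ?T = "prox \<gamma> g (Z y)"
    have "norm (?T - xs) < \<epsilon>" using r(2)[of y] y by (simp add: dist_norm norm_minus_commute)
    from growth[OF this] have "f xs + g_prox (Z xs) + c * (norm (?T - xs))\<^sup>2 \<le> f ?T + g_prox (Z y)"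
      using g_prox[of "Z xs"] g_prox[of "Z y"] fixp by simp
    then have 1: "f xs + g_prox (Z xs) + c * (norm (?T - xs))\<^sup>2 + L * (norm (?T - y))\<^sup>2 \<le> fbe \<gamma> f gradf g y"
      using fbe_lower[of y] by linarith
    have "norm (y - xs) \<le> norm (?T - xs) + norm (?T - y)"
      using norm_triangle_ineq4[of "?T - xs" "?T - y"] by simp
    then have "(norm (y - xs))\<^sup>2 \<le> (norm (?T - xs) + norm (?T - y))\<^sup>2" by (rule power_mono) simp
    also have "\<dots> \<le> 2 * (norm (?T - xs))\<^sup>2 + 2 * (norm (?T - y))\<^sup>2"
      using sum_squares_bound[of "norm (?T - xs)" "norm (?T - y)"] by (simp add: power2_sum)
    finally have "min c L / 2 * (norm (y - xs))\<^sup>2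
        \<le> min c L / 2 * (2 * (norm (?T - xs))\<^sup>2 + 2 * (norm (?T - y))\<^sup>2)"
      using c L_pos by (intro mult_left_mono) auto
    also have "\<dots> = min c L * (norm (?T - xs))\<^sup>2 + min c L * (norm (?T - y))\<^sup>2"
      by (simp add: algebra_simps)
    also have "\<dots> \<le> c * (norm (?T - xs))\<^sup>2 + L * (norm (?T - y))\<^sup>2"
      by (intro add_mono mult_right_mono) auto
    finally show ?thesis using 1 fx by linarith
  qed
  then show ?thesis using r(1) by blast
qed

section \<open>Second-order behaviour at the critical point\<close>

lemma Bmat_mult: "Bmat \<gamma> hessf y (matrix (blinfun_apply J)) *v h =
    Qmat \<gamma> hessf y *v ((1 / \<gamma>) *\<^sub>R (h - blinfun_apply J (Qmat \<gamma> hessf y *v h)))"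
  unfolding Bmat_def scaleR_matrix_vector_assoc[symmetric] matrix_vector_mul_assoc[symmetric]
    matrix_vector_mult_diff_rdistrib matrix_blinfun_works matrix_vector_mult_scaleR
  by simp

lemma Bmat_isCont:
  assumes "isCont J (Z x)"
  shows "isCont (\<lambda>y. Bmat \<gamma> hessf y (matrix (blinfun_apply (J (Z y))))) x"
proof -
  have "((\<lambda>y. J (Z y)) \<longlongrightarrow> J (Z x)) (at x)"
    using isCont_o2[OF Z_isCont assms] by (simp add: isCont_def)
  moreover have "(hessf \<longlongrightarrow> hessf x) (at x)" using hess_cont by (simp add: isCont_def)
  ultimately show ?thesis
    unfolding isCont_def Bmat_def Qmat_def
    by (intro tendsto_intros tendsto_matrix_matrix_mult tendsto_matrix_blinfun)
qed

text \<open>The product rule for \<open>Qmat\<close> times the residual: differentiating the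
  residual yields \<open>Bmat\<close>, differentiating \<open>Qmat\<close> yields the term with
  \<open>H'\<close>.\<close>

lemma fbe_grad_has_derivative:
  fixes H' :: "(real^'n) \<Rightarrow>\<^sub>L (real^'n^'n)"
  assumes S: "open S" "Z x \<in> S"
    and J: "\<And>z. z \<in> S \<Longrightarrow> (prox \<gamma> g has_derivative blinfun_apply (J z)) (at z)"
    and H': "(hessf has_derivative blinfun_apply H') (at x)"
  shows "(fbe_grad \<gamma> f gradf g has_derivative
      (\<lambda>h. Bmat \<gamma> hessf x (matrix (blinfun_apply (J (Z x)))) *v h
         - \<gamma> *\<^sub>R (H' h *v fb_res \<gamma> gradf g x))) (at x)"
proof -
  have P: "((\<lambda>y. prox \<gamma> g (Z y)) has_derivative (\<lambda>h. J (Z x) (Qmat \<gamma> hessf x *v h))) (at x)"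
    by (rule has_derivative_compose[OF Z_has_derivative J[OF S(2)]])
  have R: "(fb_res \<gamma> gradf g has_derivative
      (\<lambda>h. (1 / \<gamma>) *\<^sub>R (h - J (Z x) (Qmat \<gamma> hessf x *v h)))) (at x)"
    unfolding fb_res_eq[abs_def]
    by (intro has_derivative_scaleR_right has_derivative_diff has_derivative_ident P)
  have Q: "(Qmat \<gamma> hessf has_derivative (\<lambda>h. - (\<gamma> *\<^sub>R H' h))) (at x)"
    unfolding Qmat_def[abs_def]
    using has_derivative_diff[OF has_derivative_const has_derivative_scaleR_right[OF H']] by simp
  have "((\<lambda>y. Qmat \<gamma> hessf y *v fb_res \<gamma> gradf g y) has_derivative
      (\<lambda>h. Qmat \<gamma> hessf x *v ((1 / \<gamma>) *\<^sub>R (h - J (Z x) (Qmat \<gamma> hessf x *v h)))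
         + - (\<gamma> *\<^sub>R H' h) *v fb_res \<gamma> gradf g x)) (at x)"
    by (rule has_derivative_matrix_vector_mult[OF Q R])
  moreover have "- (\<gamma> *\<^sub>R H' h) *v v = - (\<gamma> *\<^sub>R (H' h *v v))" for h v
    using matrix_vector_mult_diff_rdistrib[of 0 "\<gamma> *\<^sub>R H' h" v]
    by (simp add: scaleR_matrix_vector_assoc)
  ultimately have D: "((\<lambda>y. Qmat \<gamma> hessf y *v fb_res \<gamma> gradf g y) has_derivative
      (\<lambda>h. Bmat \<gamma> hessf x (matrix (blinfun_apply (J (Z x)))) *v h
         - \<gamma> *\<^sub>R (H' h *v fb_res \<gamma> gradf g x))) (at x)"
    by (simp add: Bmat_mult)
  have "open (Z -` S)" using S(1) Z_isCont by (intro continuous_open_vimage) auto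
  then show ?thesis
  proof (rule has_derivative_transform_within_open[OF D])
    show "x \<in> Z -` S" using S by simp
    show "Qmat \<gamma> hessf y *v fb_res \<gamma> gradf g y = fbe_grad \<gamma> f gradf g y" if "y \<in> Z -` S" for y
      using that fbe_grad_eq[OF has_derivative_continuous[OF J]] by simp
  qed
qed

text \<open>Nearby derivatives differ from the matrix at \<open>xs\<close> by the variation of
  \<open>Bmat\<close> and by the third-order term times the residual. Both vanish at
  \<open>xs\<close>, the latter because \<open>xs\<close> is a fixed point.\<close>

lemma fbe_grad_has_strict_jacobian:
  fixes H' :: "real^'n \<Rightarrow> (real^'n) \<Rightarrow>\<^sub>L (real^'n^'n)"
  assumes fixp: "prox \<gamma> g (Z xs) = xs"
    and S: "open S" "Z xs \<in> S"
    and J: "\<And>z. z \<in> S \<Longrightarrow> (prox \<gamma> g has_derivative blinfun_apply (J z)) (at z)"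
    and J_cont: "continuous_on S J"
    and U: "open U" "xs \<in> U"
    and H': "\<And>y. y \<in> U \<Longrightarrow> (hessf has_derivative blinfun_apply (H' y)) (at y)"
    and H'_cont: "continuous_on U H'"
  shows "has_strict_jacobian (fbe_grad \<gamma> f gradf g) (Bmat \<gamma> hessf xs (matrix (blinfun_apply (J (Z xs))))) xs"
proof (rule has_strict_jacobianI)
  fix e :: real assume e: "e > 0"
  let ?B = "\<lambda>y. Bmat \<gamma> hessf y (matrix (blinfun_apply (J (Z y))))"
  let ?R = "fb_res \<gamma> gradf g"
  define err where "err y = norm (?B y - ?B xs) + \<gamma> * (norm (H' y) * norm (?R y))" for y
  have R0: "?R xs = 0" by (simp add: fb_res_eq fixp)
  have "isCont (prox \<gamma> g) (Z xs)" using J[OF S(2)] has_derivative_continuous by blast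
  then have "isCont ?R xs"
    unfolding fb_res_eq[abs_def] by (intro continuous_intros isCont_o2[OF Z_isCont])
  moreover have "isCont H' xs" using H'_cont U by (simp add: continuous_on_eq_continuous_at)
  moreover have "isCont ?B xs"
    using J_cont S by (intro Bmat_isCont) (simp add: continuous_on_eq_continuous_at)
  ultimately have "isCont err xs" unfolding err_def by (intro continuous_intros)
  then have "(err \<longlongrightarrow> err xs) (nhds xs)"
    unfolding isCont_def tendsto_at_iff_tendsto_nhds .
  moreover have "err xs < e" using e by (simp add: err_def R0)
  ultimately have "\<forall>\<^sub>F y in nhds xs. err y < e" by (rule order_tendstoD)
  moreover have "\<forall>\<^sub>F y in nhds xs. y \<in> U" using U by (rule eventually_nhds_in_open)
  moreover have "\<forall>\<^sub>F y in nhds xs. y \<in> Z -` S"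
    using S Z_isCont by (intro eventually_nhds_in_open continuous_open_vimage) auto
  ultimately have "\<forall>\<^sub>F y in nhds xs. \<exists>D. (fbe_grad \<gamma> f gradf g has_derivative D) (at y) \<and>
      (\<forall>h. norm (D h - ?B xs *v h) \<le> e * norm h)"
  proof eventually_elim
    case (elim y)
    let ?D = "\<lambda>h. ?B y *v h - \<gamma> *\<^sub>R (H' y h *v ?R y)"
    have "(fbe_grad \<gamma> f gradf g has_derivative ?D) (at y)"
      using elim by (intro fbe_grad_has_derivative[OF S(1) _ J H']) auto
    moreover have "norm (?D h - ?B xs *v h) \<le> e * norm h" for h
    proof -
      have "?D h - ?B xs *v h = (?B y - ?B xs) *v h - \<gamma> *\<^sub>R (H' y h *v ?R y)"
        by (simp add: matrix_vector_mult_diff_rdistrib)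
      then have "norm (?D h - ?B xs *v h) \<le> norm ((?B y - ?B xs) *v h) + norm (\<gamma> *\<^sub>R (H' y h *v ?R y))"
        using norm_triangle_ineq4 by metis
      also have "\<dots> \<le> norm (?B y - ?B xs) * norm h + \<gamma> * (norm (H' y) * norm h * norm (?R y))"
      proof (rule add_mono)
        have "norm (H' y h *v ?R y) \<le> norm (H' y h) * norm (?R y)" by (rule norm_matrix_vector_mult_le)
        also have "\<dots> \<le> norm (H' y) * norm h * norm (?R y)"
          by (intro mult_right_mono norm_blinfun) auto
        finally show "norm (\<gamma> *\<^sub>R (H' y h *v ?R y)) \<le> \<gamma> * (norm (H' y) * norm h * norm (?R y))"
          using \<gamma>_pos by simp
      qed (rule norm_matrix_vector_mult_le)
      also have "\<dots> = err y * norm h" by (simp add: err_def algebra_simps)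
      also have "\<dots> \<le> e * norm h" using elim by (intro mult_right_mono) auto
      finally show ?thesis .
    qed
    ultimately show ?case by blast
  qed
  then show "\<exists>r>0. \<forall>y\<in>ball xs r. \<exists>D. (fbe_grad \<gamma> f gradf g has_derivative D) (at y) \<and>
      (\<forall>h. norm (D h - ?B xs *v h) \<le> e * norm h)"
    unfolding eventually_nhds_metric Ball_def mem_ball dist_commute[of xs] .
qed

text \<open>The limit matrix is \<open>Bmat\<close> at \<open>xs\<close> with the Jacobian of
  \<open>prox\<close>; its coercivity constant \<open>min c L / 2\<close> comes from the quadratic
  growth of the envelope.\<close>

lemma ntra_run_newton_trust_region:
  fixes H' :: "real^'n \<Rightarrow> (real^'n) \<Rightarrow>\<^sub>L (real^'n^'n)"
  assumes run: "ntra_run \<gamma> f gradf hessf g \<delta>0 \<mu>1 \<mu>2 c1 c2 c3 x0 x d \<delta> P"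
    and crit: "critical_pt \<gamma> gradf g xs"
    and lim: "(x \<circ> r) \<longlonglongrightarrow> xs"
    and \<epsilon>J: "\<epsilon>J > 0"
    and J: "\<And>z. z \<in> ball (Z xs) \<epsilon>J \<Longrightarrow> (prox \<gamma> g has_derivative blinfun_apply (J z)) (at z)"
    and J_cont: "continuous_on (ball (Z xs) \<epsilon>J) J"
    and \<epsilon>H: "\<epsilon>H > 0"
    and H': "\<And>y. y \<in> ball xs \<epsilon>H \<Longrightarrow> (hessf has_derivative blinfun_apply (H' y)) (at y)"
    and H'_cont: "continuous_on (ball xs \<epsilon>H) H'"
    and c: "c > 0" and \<epsilon>: "\<epsilon> > 0"
    and growth: "\<And>y. norm (y - xs) < \<epsilon> \<Longrightarrow>
      ereal (f xs) + g xs + ereal (c * (norm (y - xs))\<^sup>2) \<le> ereal (f y) + g y"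
    and \<beta>: "0 < \<beta>"
    and cauchy: "\<And>k. \<beta> * norm (fbe_grad \<gamma> f gradf g (x k))
          * cauchy_min (\<delta> k) (norm (fbe_grad \<gamma> f gradf g (x k))) (Bmat \<gamma> hessf (x k) (P k))
        \<le> tr_model \<gamma> f gradf hessf g (x k) (P k) 0 - tr_model \<gamma> f gradf hessf g (x k) (P k) (d k)"
    and newton: "\<And>k. pos_def (Bmat \<gamma> hessf (x k) (P k)) \<Longrightarrow>
        norm (- (matrix_inv (Bmat \<gamma> hessf (x k) (P k)) *v fbe_grad \<gamma> f gradf g (x k))) \<le> \<delta> k \<Longrightarrow>
        d k = - (matrix_inv (Bmat \<gamma> hessf (x k) (P k)) *v fbe_grad \<gamma> f gradf g (x k))"
  shows "\<exists>Bs r0 lam. newton_trust_region (fbe \<gamma> f gradf g) (fbe_grad \<gamma> f gradf g) xs Bs x d \<delta>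
      (\<lambda>k. Bmat \<gamma> hessf (x k) (P k))
      (\<lambda>k. tr_model \<gamma> f gradf hessf g (x k) (P k) 0 - tr_model \<gamma> f gradf hessf g (x k) (P k) (d k))
      r0 lam \<beta> \<mu>1 \<mu>2 c1 c2 c3"
proof -
  let ?F = "fbe \<gamma> f gradf g" and ?G = "fbe_grad \<gamma> f gradf g"
  let ?B = "\<lambda>y. Bmat \<gamma> hessf y (matrix (blinfun_apply (J (Z y))))"
  let ?S = "ball (Z xs) \<epsilon>J"
  have fixp: "prox \<gamma> g (Z xs) = xs" using crit by (simp add: critical_pt_def fb_op_eq)
  have ZS: "Z xs \<in> ?S" using \<epsilon>J by simp
  have prox_cont: "isCont (prox \<gamma> g) z" if "z \<in> ?S" for z
    using J[OF that] has_derivative_continuous by blast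
  have strict: "has_strict_jacobian ?G (?B xs) xs"
    by (rule fbe_grad_has_strict_jacobian[OF fixp open_ball ZS J J_cont open_ball _ H' H'_cont])
      (use \<epsilon>H in auto)
  obtain r1 where r1: "r1 > 0" "\<And>y. y \<in> ball xs r1 \<Longrightarrow> Z y \<in> ?S"
    using Z_isCont[of xs] \<epsilon>J unfolding continuous_at_eps_delta mem_ball by (metis dist_commute)
  obtain r2 where r2: "r2 > 0" "\<And>y. y \<in> ball xs r2 \<Longrightarrow> ?F xs + min c L / 2 * (norm (y - xs))\<^sup>2 \<le> ?F y"
    using fbe_quadratic_growth[OF fixp prox_cont[OF ZS] c \<epsilon> growth] by blast
  have der: "(?F has_derivative (\<lambda>h. ?G y \<bullet> h)) (at y)" if "y \<in> ball xs r1" for y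
    using fbe_has_derivative[OF prox_cont] fbe_grad_eq[OF prox_cont] r1(2)[OF that] by metis
  have G0: "?G xs = 0"
    using fbe_grad_eq[OF prox_cont[OF ZS]] by (simp add: fb_res_eq fixp)
  have lam: "0 < min c L / 2" using c L_pos by simp
  \<comment> \<open>For iterates near \<open>xs\<close> the forward point lies where
    \<open>prox\<close> is continuously differentiable, so the Clarke choice is forced.\<close>
  have P_eq: "P k = matrix (blinfun_apply (J (Z (x k))))" if "x k \<in> ball xs r1" for k
    using run r1(2)[OF that] unfolding ntra_run_def
    by (intro clarke_jac_continuously_differentiable[OF open_ball _ J J_cont]) (auto simp: Z_def)
  have B_near: "\<exists>r>0. \<forall>k. x k \<in> ball xs r \<longrightarrow>
      (\<forall>v. norm (Bmat \<gamma> hessf (x k) (P k) *v v - ?B xs *v v) \<le> e * norm v)" if e: "e > 0" for e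
  proof -
    have "isCont ?B xs"
      using J_cont ZS by (intro Bmat_isCont) (simp add: continuous_on_eq_continuous_at)
    then obtain r where r: "r > 0" "\<And>y. dist y xs < r \<Longrightarrow> dist (?B y) (?B xs) < e"
      using e unfolding continuous_at_eps_delta by blast
    have "norm (Bmat \<gamma> hessf (x k) (P k) *v v - ?B xs *v v) \<le> e * norm v"
      if k: "x k \<in> ball xs (min r r1)" for k v
    proof -
      have "norm (?B (x k) *v v - ?B xs *v v) \<le> norm (?B (x k) - ?B xs) * norm v"
        unfolding matrix_vector_mult_diff_rdistrib[symmetric] by (rule norm_matrix_vector_mult_le)
      also have "\<dots> \<le> e * norm v"
        using r(2)[of "x k"] k by (intro mult_right_mono) (auto simp: dist_norm norm_minus_commute)
      finally show ?thesis using P_eq k by simp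
    qed
    then show ?thesis using r(1) r1(1) by (intro exI[of _ "min r r1"]) auto
  qed
  have "newton_trust_region ?F ?G xs (?B xs) x d \<delta> (\<lambda>k. Bmat \<gamma> hessf (x k) (P k))
      (\<lambda>k. tr_model \<gamma> f gradf hessf g (x k) (P k) 0 - tr_model \<gamma> f gradf hessf g (x k) (P k) (d k))
      r1 (min c L / 2) \<beta> \<mu>1 \<mu>2 c1 c2 c3"
  proof
    show "min c L / 2 * (norm v)\<^sup>2 \<le> v \<bullet> (?B xs *v v)" for v
      by (rule quadratic_growth_coercive[of "min r1 r2" _ xs ?F ?G])
        (use r1(1) r2 lam der strict G0 in auto)
    show "\<exists>r>0. \<forall>k. x k \<in> ball xs r \<longrightarrow>
        (\<forall>v. norm (Bmat \<gamma> hessf (x k) (P k) *v v - ?B xs *v v) \<le> e * norm v)" if "e > 0" for e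
      by (rule B_near[OF that])
    \<comment> \<open>At \<open>xs\<close> the residual is zero, so a positive definite matrix would
      trigger the stopping test, which the run excludes.\<close>
    show "\<not> pos_def (Bmat \<gamma> hessf (x k) (P k))" if "x k = xs" for k
    proof
      assume "pos_def (Bmat \<gamma> hessf (x k) (P k))"
      moreover have "fb_res \<gamma> gradf g (x k) = 0" by (simp add: fb_res_eq fixp that)
      ultimately show False using run pos_def_min_eig_nonneg unfolding ntra_run_def by blast
    qed
    show "\<exists>k. x k \<in> ball xs e" if "e > 0" for e
      using lim that unfolding lim_sequentially by (auto simp: dist_commute)
  qed (use run r1 der strict G0 lam \<beta> cauchy newton in
      \<open>auto simp: ntra_run_def tr_ratio_def tr_model_def\<close>)
  then show ?thesis by blast
qed

end

section \<open>Convergence of the trust-region method on the forward-backward envelope\<close>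

theorem theorem4p11:
  fixes f :: "real^'n \<Rightarrow> real" and gradf :: "real^'n \<Rightarrow> real^'n"
    and hessf :: "real^'n \<Rightarrow> real^'n^'n" and g :: "real^'n \<Rightarrow> ereal"
    and L \<rho> :: real and xs :: "real^'n"
  assumes f_grad: "\<forall>x. (f has_derivative (\<lambda>h. gradf x \<bullet> h)) (at x)"
    and f_hess: "\<forall>x. (gradf has_derivative (\<lambda>h. hessf x *v h)) (at x)"
    and hess_loc_lip: "\<forall>x. \<exists>\<epsilon>>0. \<exists>K. \<forall>y\<in>ball x \<epsilon>. \<forall>z\<in>ball x \<epsilon>.
                          norm (hessf y - hessf z) \<le> K * norm (y - z)"
    and L_pos: "L > 0"
    and grad_lip: "\<forall>x y. norm (gradf x - gradf y) \<le> L * norm (x - y)"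
    and g_proper: "proper_fun g" and g_lsc: "lsc_fun g"
    and \<rho>_pos: "\<rho> > 0" and g_wc: "weakly_convex \<rho> g"
    and argmin_ne: "\<exists>z. \<forall>y. ereal (f z) + g z \<le> ereal (f y) + g y"
    and f_C3: "\<exists>\<epsilon>>0. \<exists>H' :: real^'n \<Rightarrow> ((real^'n) \<Rightarrow>\<^sub>L (real^'n^'n)).
                 (\<forall>y\<in>ball xs \<epsilon>. (hessf has_derivative blinfun_apply (H' y)) (at y))
                 \<and> continuous_on (ball xs \<epsilon>) H'"
    and strong_min: "\<exists>c>0. \<exists>\<epsilon>>0. \<forall>y. norm (y - xs) < \<epsilon> \<longrightarrow>
                 ereal (f y) + g y \<ge> ereal (f xs) + g xs + ereal (c * (norm (y - xs))\<^sup>2)"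
  shows "\<exists>\<gamma>bar>0. \<forall>\<gamma> \<delta>0 \<mu>1 \<mu>2 c1 c2 c3 \<beta> x0 x d \<delta> P.
     (0 < \<gamma> \<and> \<gamma> < \<gamma>bar \<and> \<gamma> < 1 / L \<and> \<gamma> < 1 / \<rho>
      \<and> ntra_run \<gamma> f gradf hessf g \<delta>0 \<mu>1 \<mu>2 c1 c2 c3 x0 x d \<delta> P
      \<and> bounded {y. ereal (f y) + g y \<le> ereal (f x0) + g x0}
      \<and> critical_pt \<gamma> gradf g xs
      \<and> (\<exists>r. strict_mono r \<and> (x \<circ> r) \<longlonglongrightarrow> xs)
      \<and> (\<exists>\<epsilon>>0. \<exists>J :: real^'n \<Rightarrow> ((real^'n) \<Rightarrow>\<^sub>L (real^'n)).
            (\<forall>z\<in>ball (xs - \<gamma> *\<^sub>R gradf xs) \<epsilon>. (prox \<gamma> g has_derivative blinfun_apply (J z)) (at z))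
            \<and> continuous_on (ball (xs - \<gamma> *\<^sub>R gradf xs) \<epsilon>) J)
      \<and> 0 < \<beta> \<and> \<beta> < 1
      \<and> (\<forall>k. tr_model \<gamma> f gradf hessf g (x k) (P k) 0 - tr_model \<gamma> f gradf hessf g (x k) (P k) (d k)
              \<ge> \<beta> * norm (fbe_grad \<gamma> f gradf g (x k))
                  * cauchy_min (\<delta> k) (norm (fbe_grad \<gamma> f gradf g (x k))) (Bmat \<gamma> hessf (x k) (P k)))
      \<and> (\<forall>k. pos_def (Bmat \<gamma> hessf (x k) (P k))
              \<and> norm (- (matrix_inv (Bmat \<gamma> hessf (x k) (P k)) *v fbe_grad \<gamma> f gradf g (x k))) \<le> \<delta> k
              \<longrightarrow> d k = - (matrix_inv (Bmat \<gamma> hessf (x k) (P k)) *v fbe_grad \<gamma> f gradf g (x k))))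
     \<longrightarrow>
     (x \<longlonglongrightarrow> xs
      \<and> (\<forall>\<^sub>F k in sequentially.
           pos_def (Bmat \<gamma> hessf (x k) (P k))
           \<and> norm (- (matrix_inv (Bmat \<gamma> hessf (x k) (P k)) *v fbe_grad \<gamma> f gradf g (x k))) \<le> \<delta> k
           \<and> d k = - (matrix_inv (Bmat \<gamma> hessf (x k) (P k)) *v fbe_grad \<gamma> f gradf g (x k))
           \<and> tr_ratio \<gamma> f gradf hessf g (x k) (P k) (d k) \<ge> \<mu>1
           \<and> x (Suc k) = x k + d k)
      \<and> (\<lambda>k. norm (x (Suc k) - xs)) \<in> o(\<lambda>k. norm (x k - xs)))"
\<comment> \<open>The stepsize threshold is the one of \<open>forward_backward\<close>; it depends
  only on \<open>L\<close> and precedes every algorithmic choice.\<close>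
proof (rule exI[of _ "1 / (4 * L)"], rule conjI, use L_pos in simp,
    intro allI impI, elim conjE, goal_cases)
  case (1 \<gamma> \<delta>0 \<mu>1 \<mu>2 c1 c2 c3 \<beta> x0 x d \<delta> P)
  interpret forward_backward f gradf hessf g L \<rho> \<gamma>
  proof
    show "isCont hessf y" for y
    proof -
      obtain \<epsilon> K where \<epsilon>: "\<epsilon> > 0" and K: "\<forall>w\<in>ball y \<epsilon>. \<forall>z\<in>ball y \<epsilon>. norm (hessf w - hessf z) \<le> K * norm (w - z)"
        using hess_loc_lip by blast
      have "((\<lambda>w. K * norm (w - y)) \<longlongrightarrow> K * norm (y - y)) (at y)" by (intro tendsto_intros)
      moreover have "\<forall>\<^sub>F w in at y. norm (hessf w - hessf y) \<le> K * norm (w - y)"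
        unfolding eventually_at using \<epsilon> K by (intro exI[of _ \<epsilon>]) (auto simp: dist_commute)
      ultimately have "((\<lambda>w. hessf w - hessf y) \<longlongrightarrow> 0) (at y)"
        by (intro Lim_null_comparison[where f = "\<lambda>w. hessf w - hessf y"]) simp_all
      then show ?thesis by (simp add: isCont_def LIM_zero_iff)
    qed
    show "\<gamma> * \<rho> < 1" using 1(4) \<rho>_pos by (simp add: field_simps)
  qed (use assms 1 in auto)
  obtain r where r: "(x \<circ> r) \<longlonglongrightarrow> xs" using 1(8) by blast
  obtain \<epsilon>J J where J: "\<epsilon>J > 0"
    "\<And>z. z \<in> ball (Z xs) \<epsilon>J \<Longrightarrow> (prox \<gamma> g has_derivative blinfun_apply (J z)) (at z)"
    "continuous_on (ball (Z xs) \<epsilon>J) J"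
    using 1(9) unfolding Z_def by blast
  obtain \<epsilon>H H' where H': "\<epsilon>H > 0"
    "\<And>y. y \<in> ball xs \<epsilon>H \<Longrightarrow> (hessf has_derivative blinfun_apply (H' y)) (at y)"
    "continuous_on (ball xs \<epsilon>H) H'"
    using f_C3 by blast
  obtain c \<epsilon> where c: "c > 0" "\<epsilon> > 0" "\<And>y. norm (y - xs) < \<epsilon> \<Longrightarrow>
      ereal (f xs) + g xs + ereal (c * (norm (y - xs))\<^sup>2) \<le> ereal (f y) + g y"
    using strong_min by blast
  obtain Bs r0 lam where "newton_trust_region (fbe \<gamma> f gradf g) (fbe_grad \<gamma> f gradf g) xs Bs x d \<delta>
      (\<lambda>k. Bmat \<gamma> hessf (x k) (P k))
      (\<lambda>k. tr_model \<gamma> f gradf hessf g (x k) (P k) 0 - tr_model \<gamma> f gradf hessf g (x k) (P k) (d k))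
      r0 lam \<beta> \<mu>1 \<mu>2 c1 c2 c3"
    using ntra_run_newton_trust_region[OF 1(5,7) r J H' c 1(10)] 1(12,13) by blast
  then interpret newton_trust_region "fbe \<gamma> f gradf g" "fbe_grad \<gamma> f gradf g" xs Bs x d \<delta>
    "\<lambda>k. Bmat \<gamma> hessf (x k) (P k)"
    "\<lambda>k. tr_model \<gamma> f gradf hessf g (x k) (P k) 0 - tr_model \<gamma> f gradf hessf g (x k) (P k) (d k)"
    r0 lam \<beta> \<mu>1 \<mu>2 c1 c2 c3 .
  show ?case
    using converges eventually_newton superlinear unfolding tr_ratio_def by blast
qed

end
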